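(* Let $\xi$ be an ordinal with $0<\xi<\omega_1$. Then the class $\mathfrak{SM}_1^\xi$ and the class $\mathfrak{WC}^\xi$ both have the factorization property. That is: for every operator $A$ in $\mathfrak{SM}_1^\xi$ there exist a Banach space $Z$ whose identity $I_Z$ lies in $\mathfrak{SM}_1^\xi$ and operators $B,C$ with $A=BC$ factoring through $Z$; and likewise for every operator $A$ in $\mathfrak{WC}^\xi$ there is a Banach space $Z$ with $I_Z\in\mathfrak{WC}^\xi$ through which $A$ factors.
   Context: Operators are bounded linear maps between Banach spaces. Finite subsets of $\mathbb{N}$ are identified with strictly increasing finite sequences; for finite $E,F\subset\mathbb{N}$ write $E<F$ if $\max E<\min F$ or either is empty, and $n\leqslant E$ if $n\leqslant\min E$. Schreier families: $\mathcal{S}_0=\{E\subset\mathbb{N}:|E|\leqslant 1\}$; $\mathcal{S}_{\xi+1}=\{\bigcup_{i=1}^n E_i: n\in\mathbb{N}, n\leqslant E_1<\dots<E_n, \varnothing\neq E_i\in\mathcal{S}_\xi\}$; for a countable limit ordinal $\xi$, fix $\xi_n\uparrow\xi$ and set $\mathcal{S}_\xi=\{E:\exists n\leqslant E\in\mathcal{S}_{\xi_n}\}$. A bounded sequence $(x_n)$ in a Banach space is an $\ell_1^\xi$ spreading model if there is $K>0$ such that for every $E\in\mathcal{S}_\xi$ and scalars $(a_i)_{i\in E}$, $K^{-1}\sum_{i\in E}|a_i|\leqslant\|\sum_{i\in E}a_ix_i\|$. $\mathfrak{SM}_1^\xi$ is the class of operators $A:X\to Y$ such that for no $\ell_1^\xi$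 spreading model $(x_i)\subset X$ is $(Ax_i)$ an $\ell_1^\xi$ spreading model. $\mathfrak{WC}^\xi$ is the class of weakly compact operators lying in $\mathfrak{SM}_1^\xi$. *)

theory Defs
  imports "HOL-Analysis.Analysis"
begin

section \<open>Countable ordinals as Brouwer ordinal notations\<close>

datatype ordn = OZero | OSucc ordn | OLim "nat \<Rightarrow> ordn"

text \<open>Ordinal order on notations (Kraus, Nordvall Forsberg, Xu).\<close>
inductive ord_le :: "ordn \<Rightarrow> ordn \<Rightarrow> bool" where
  zero_le: "ord_le OZero y"
| succ_mono: "ord_le x y \<Longrightarrow> ord_le (OSucc x) (OSucc y)"
| le_lim: "ord_le x (f k) \<Longrightarrow> ord_le x (OLim f)"
| lim_le: "(\<forall>k. ord_le (f k) y) \<Longrightarrow> ord_le (OLim f) y"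

definition ord_less :: "ordn \<Rightarrow> ordn \<Rightarrow> bool" where
  "ord_less x y \<longleftrightarrow> ord_le (OSucc x) y"

text \<open>Well-formed notations: limit notations are given by strictly increasing
  sequences (xi_1 < xi_2 < ...); the limit notation denotes their supremum.\<close>
inductive ord_wf :: "ordn \<Rightarrow> bool" where
  "ord_wf OZero"
| "ord_wf x \<Longrightarrow> ord_wf (OSucc x)"
| "(\<forall>n. ord_wf (f n) \<and> ord_less (f n) (f (Suc n))) \<Longrightarrow> ord_wf (OLim f)"

section \<open>Schreier families (finite subsets of the positive integers)\<close>

text \<open>For a limit notation OLim f we use xi_(n+1) = f n, so the condition
  "n \<le> E" with n \<ge> 1 becomes "Suc n \<le> min E".\<close>
primrec schreier :: "ordn \<Rightarrow> nat set set" where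
  "schreier OZero = {E. finite E \<and> E \<subseteq> {1..} \<and> card E \<le> 1}"
| "schreier (OSucc x) =
     {E. \<exists>n::nat. \<exists>F::nat \<Rightarrow> nat set. 1 \<le> n \<and>
         (\<forall>i<n. F i \<noteq> {} \<and> F i \<in> schreier x) \<and>
         (\<forall>i. Suc i < n \<longrightarrow> Max (F i) < Min (F (Suc i))) \<and>
         n \<le> Min (F 0) \<and> E = (\<Union>i<n. F i)}"
| "schreier (OLim f) =
     {E. \<exists>n::nat. (E = {} \<or> Suc n \<le> Min E) \<and> E \<in> schreier (f n)}"

section \<open>Abstract real normed spaces on an explicit carrier\<close>

record 'a nspace =
  carrier :: "'a set"
  add :: "'a \<Rightarrow> 'a \<Rightarrow> 'a"
  scal :: "real \<Rightarrow> 'a \<Rightarrow> 'a"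
  zer :: "'a"
  nrm :: "'a \<Rightarrow> real"

definition banach_sp :: "'a nspace \<Rightarrow> bool" where
  "banach_sp Z \<longleftrightarrow>
     zer Z \<in> carrier Z \<and>
     (\<forall>x\<in>carrier Z. \<forall>y\<in>carrier Z. add Z x y \<in> carrier Z) \<and>
     (\<forall>a. \<forall>x\<in>carrier Z. scal Z a x \<in> carrier Z) \<and>
     (\<forall>x\<in>carrier Z. \<forall>y\<in>carrier Z. \<forall>z\<in>carrier Z. add Z (add Z x y) z = add Z x (add Z y z)) \<and>
     (\<forall>x\<in>carrier Z. \<forall>y\<in>carrier Z. add Z x y = add Z y x) \<and>
     (\<forall>x\<in>carrier Z. add Z x (zer Z) = x) \<and>
     (\<forall>x\<in>carrier Z. \<exists>y\<in>carrier Z. add Z x y = zer Z) \<and>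
     (\<forall>a. \<forall>x\<in>carrier Z. \<forall>y\<in>carrier Z. scal Z a (add Z x y) = add Z (scal Z a x) (scal Z a y)) \<and>
     (\<forall>a b. \<forall>x\<in>carrier Z. scal Z (a + b) x = add Z (scal Z a x) (scal Z b x)) \<and>
     (\<forall>a b. \<forall>x\<in>carrier Z. scal Z a (scal Z b x) = scal Z (a * b) x) \<and>
     (\<forall>x\<in>carrier Z. scal Z 1 x = x) \<and>
     (\<forall>x\<in>carrier Z. nrm Z x = 0 \<longleftrightarrow> x = zer Z) \<and>
     (\<forall>a. \<forall>x\<in>carrier Z. nrm Z (scal Z a x) = \<bar>a\<bar> * nrm Z x) \<and>
     (\<forall>x\<in>carrier Z. \<forall>y\<in>carrier Z. nrm Z (add Z x y) \<le> nrm Z x + nrm Z y) \<and>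
     (\<forall>s. (\<forall>n. s n \<in> carrier Z) \<longrightarrow>
          (\<forall>e>0. \<exists>N::nat. \<forall>m\<ge>N. \<forall>n\<ge>N. nrm Z (add Z (s m) (scal Z (-1) (s n))) < e) \<longrightarrow>
          (\<exists>l\<in>carrier Z. \<forall>e>0. \<exists>N::nat. \<forall>n\<ge>N. nrm Z (add Z (s n) (scal Z (-1) l)) < e))"

text \<open>A Banach space given by a type of class banach.\<close>
definition type_sp :: "'a::real_normed_vector nspace" where
  "type_sp = \<lparr>carrier = UNIV, add = (+), scal = (*\<^sub>R), zer = 0, nrm = norm\<rparr>"

text \<open>Operators = bounded linear maps.\<close>
definition operator :: "'a nspace \<Rightarrow> 'b nspace \<Rightarrow> ('a \<Rightarrow> 'b) \<Rightarrow> bool" where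
  "operator Z W T \<longleftrightarrow>
     (\<forall>x\<in>carrier Z. T x \<in> carrier W) \<and>
     (\<forall>x\<in>carrier Z. \<forall>y\<in>carrier Z. T (add Z x y) = add W (T x) (T y)) \<and>
     (\<forall>a. \<forall>x\<in>carrier Z. T (scal Z a x) = scal W a (T x)) \<and>
     (\<exists>K. \<forall>x\<in>carrier Z. nrm W (T x) \<le> K * nrm Z x)"

text \<open>Finite sums in an abstract space (in increasing order of the index).\<close>
definition nsum :: "'a nspace \<Rightarrow> nat set \<Rightarrow> (nat \<Rightarrow> 'a) \<Rightarrow> 'a" where
  "nsum Z E g = foldr (add Z) (map g (sorted_list_of_set E)) (zer Z)"

definition l1_spreading_model :: "ordn \<Rightarrow> 'a nspace \<Rightarrow> (nat \<Rightarrow> 'a) \<Rightarrow> bool" where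
  "l1_spreading_model \<xi> Z x \<longleftrightarrow>
     (\<forall>n. x n \<in> carrier Z) \<and> (\<exists>M. \<forall>n. nrm Z (x n) \<le> M) \<and>
     (\<exists>K>0. \<forall>E\<in>schreier \<xi>. \<forall>a::nat \<Rightarrow> real.
        (1 / K) * (\<Sum>i\<in>E. \<bar>a i\<bar>) \<le> nrm Z (nsum Z E (\<lambda>i. scal Z (a i) (x i))))"

text \<open>The class SM_1^xi.\<close>
definition SM1 :: "ordn \<Rightarrow> 'a nspace \<Rightarrow> 'b nspace \<Rightarrow> ('a \<Rightarrow> 'b) \<Rightarrow> bool" where
  "SM1 \<xi> Z W T \<longleftrightarrow> operator Z W T \<and>
     \<not> (\<exists>x. l1_spreading_model \<xi> Z x \<and> l1_spreading_model \<xi> W (T \<circ> x))"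

text \<open>Weak topology: the topology on the carrier generated by all bounded
  linear functionals.\<close>
definition weak_top :: "'a nspace \<Rightarrow> 'a topology" where
  "weak_top Z = topology_generated_by
     {carrier Z \<inter> \<phi> -` U | \<phi> U. operator Z (type_sp :: real nspace) \<phi> \<and> open U}"

definition weakly_compact_op :: "'a nspace \<Rightarrow> 'b nspace \<Rightarrow> ('a \<Rightarrow> 'b) \<Rightarrow> bool" where
  "weakly_compact_op Z W T \<longleftrightarrow> operator Z W T \<and>
     compactin (weak_top W) (weak_top W closure_of (T ` {x \<in> carrier Z. nrm Z x \<le> 1}))"

text \<open>The class WC^xi.\<close>
definition WC :: "ordn \<Rightarrow> 'a nspace \<Rightarrow> 'b nspace \<Rightarrow> ('a \<Rightarrow> 'b) \<Rightarrow> bool" where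
  "WC \<xi> Z W T \<longleftrightarrow> weakly_compact_op Z W T \<and> SM1 \<xi> Z W T"

end

theory Submission
  imports Defs
begin

text \<open>
  The space Z is the Davis--Figiel--Johnson--Pelczynski interpolation space of A. Let q n be the
  norm on the target given by the K-functional, q n y = inf {|x| / 2^n + 2^n |y - A x|}, and let
  N y be the l2-norm of the sequence (q n y). Every q n is equivalent to the original norm, every
  y with N y finite is a limit of values A x, and A maps into {N < \<infinity>} boundedly.

  Let (z i) be an l1-xi spreading model for N. After passing to a subsequence, the sequences
  (q n (z i)) have pairwise small inner products on a tail {p..}, so on that tail
  N behaves up to epsilon like an upper l2 estimate. Since xi > 0, averages over blocks of a fixed
  length m still span l1 on the sets of the Schreier family, and for m large the tail contributes
  little to them. So the first p coordinates, and hence the original norm, see the block averages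
  as an l1-xi spreading model. Approximating them by A x with bounded x contradicts the
  assumption on A.

  If A is weakly compact, an ultrafilter on the N-ball converges weakly in the target, because the
  ball lies in 2^n A(ball) + 2^(-n) ball up to constants; the limit lies in the N-ball since N is a
  supremum of equivalent norms. By Mazur's lemma and the same subsequence estimate, the
  convergence is also weak in Z.
\<close>

section \<open>The Hahn--Banach theorem\<close>

definition sublinear :: "('a::real_vector \<Rightarrow> real) \<Rightarrow> bool" where
  "sublinear p \<longleftrightarrow> (\<forall>x y. p (x + y) \<le> p x + p y) \<and> (\<forall>a x. 0 \<le> a \<longrightarrow> p (a *\<^sub>R x) = a * p x)"

lemma sublinear_add: "sublinear p \<Longrightarrow> p (x + y) \<le> p x + p y"
  and sublinear_scale: "sublinear p \<Longrightarrow> 0 \<le> a \<Longrightarrow> p (a *\<^sub>R x) = a * p x"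
  unfolding sublinear_def by blast+

lemma sublinear_0: "sublinear p \<Longrightarrow> p 0 = 0"
  using sublinear_scale[of p 0 0] by simp

lemma sublinear_ge: "sublinear p \<Longrightarrow> - p (- x) \<le> p x"
  using sublinear_add[of p x "- x"] sublinear_0[of p] by simp

text \<open>This gives subadditivity for every functional below that is defined as an
  infimum.\<close>

lemma le_cINF_add:
  fixes f :: "'a \<Rightarrow> real" and g :: "'b \<Rightarrow> real"
  assumes "A \<noteq> {}" "B \<noteq> {}" "\<And>x y. x \<in> A \<Longrightarrow> y \<in> B \<Longrightarrow> c \<le> f x + g y"
  shows "c \<le> (INF x\<in>A. f x) + (INF y\<in>B. g y)"
proof -
  have "c - (INF x\<in>A. f x) \<le> g y" if "y \<in> B" for y
  proof -
    have "c - g y \<le> (INF x\<in>A. f x)"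
      by (rule cINF_greatest) (use assms that in \<open>auto simp: diff_le_eq\<close>)
    then show ?thesis by simp
  qed
  then have "c - (INF x\<in>A. f x) \<le> (INF y\<in>B. g y)"
    by (intro cINF_greatest) (use assms in auto)
  then show ?thesis by simp
qed

text \<open>A linear functional below \<open>p'\<close> is automatically at least \<open>d\<close>
  on \<open>S\<close>, so separation from a convex set reduces to plain domination. The witness is
  the infimum of \<open>p (y + t *\<^sub>R s) - t * d\<close> over t \<ge> 0 and s in
  \<open>S\<close>: the bound \<open>d\<close> keeps it finite, and convexity of \<open>S\<close>
  makes it subadditive.\<close>

lemma sublinear_lowering:
  fixes p :: "'a::real_vector \<Rightarrow> real"
  assumes p: "sublinear p" and S: "convex S" "S \<noteq> {}" and d: "\<And>s. s \<in> S \<Longrightarrow> d \<le> p s"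
  obtains p' where "sublinear p'" "\<And>x. p' x \<le> p x" "\<And>s. s \<in> S \<Longrightarrow> p' (- s) \<le> - d"
proof -
  define h where "h y = (\<lambda>(t, s). p (y + t *\<^sub>R s) - t * d)" for y
  define I where "I = {0::real..} \<times> S"
  define p' where "p' y = (INF i\<in>I. h y i)" for y
  have I: "I \<noteq> {}" using S by (auto simp: I_def)
  have lb: "- p (- y) \<le> h y i" if ii: "i \<in> I" for y i
  proof -
    obtain t s where i: "i = (t, s)" "0 \<le> t" "s \<in> S" using ii by (auto simp: I_def)
    have "t * d \<le> t * p s" using i d by (simp add: mult_left_mono)
    also have "\<dots> = p (t *\<^sub>R s)" using sublinear_scale[OF p] i by simp
    also have "\<dots> \<le> p (y + t *\<^sub>R s) + p (- y)"
      using sublinear_add[OF p, of "y + t *\<^sub>R s" "- y"] by simp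
    finally show ?thesis by (simp add: h_def i)
  qed
  have bdd: "bdd_below (h y ` I)" for y
    using lb by (auto intro!: bdd_belowI)
  have le: "p' y \<le> h y i" if "i \<in> I" for y i
    unfolding p'_def by (rule cINF_lower[OF bdd that])
  have le_p: "p' y \<le> p y" for y
  proof -
    obtain s where "s \<in> S" using S by auto
    then show ?thesis using le[of "(0, s)" y] by (simp add: I_def h_def)
  qed
  have add: "p' (x + y) \<le> p' x + p' y" for x y
  proof -
    have "p' (x + y) \<le> h x i + h y j" if ij: "i \<in> I" "j \<in> I" for i j
    proof -
      obtain t s t' s' where i: "i = (t, s)" "0 \<le> t" "s \<in> S" "j = (t', s')" "0 \<le> t'" "s' \<in> S"
        using ij by (auto simp: I_def)
      \<comment> \<open>Convexity merges the two multiples into one multiple of a point of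
        \<open>S\<close>. If both weights vanish, any point of \<open>S\<close> will do.\<close>
      obtain r where r: "r \<in> S" "(t + t') *\<^sub>R r = t *\<^sub>R s + t' *\<^sub>R s'"
      proof (cases "t + t' = 0")
        case True
        then have "t = 0" "t' = 0" using i by auto
        then show ?thesis using that[of s] i by simp
      next
        case False
        define r where "r = (t / (t + t')) *\<^sub>R s + (t' / (t + t')) *\<^sub>R s'"
        have "r \<in> S" unfolding r_def
          using S(1) i False by (intro convexD) (auto simp: add_divide_distrib[symmetric])
        moreover have "(t + t') *\<^sub>R r = t *\<^sub>R s + t' *\<^sub>R s'"
          unfolding r_def scaleR_add_right using False by simp
        ultimately show ?thesis using that by blast
      qed
      have "p' (x + y) \<le> h (x + y) (t + t', r)"
        by (rule le) (use i r in \<open>auto simp: I_def\<close>)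
      also have "\<dots> = p ((x + t *\<^sub>R s) + (y + t' *\<^sub>R s')) - (t + t') * d"
        unfolding h_def prod.case r by (simp add: algebra_simps)
      also have "\<dots> \<le> h x i + h y j"
        using sublinear_add[OF p, of "x + t *\<^sub>R s" "y + t' *\<^sub>R s'"]
        by (simp add: h_def i algebra_simps)
      finally show ?thesis .
    qed
    then show ?thesis
      using le_cINF_add[OF I I, of "p' (x + y)" "h x" "h y"] unfolding p'_def[of x] p'_def[of y] by blast
  qed
  have scale_le: "p' (a *\<^sub>R y) \<le> a * p' y" if a: "0 < a" for a y
  proof -
    have "p' (a *\<^sub>R y) / a \<le> h y i" if ii: "i \<in> I" for i
    proof -
      obtain t s where i: "i = (t, s)" "0 \<le> t" "s \<in> S" using ii by (auto simp: I_def)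
      have "p' (a *\<^sub>R y) \<le> h (a *\<^sub>R y) (a * t, s)"
        by (rule le) (use i a in \<open>auto simp: I_def\<close>)
      also have "\<dots> = p (a *\<^sub>R (y + t *\<^sub>R s)) - a * t * d"
        by (simp add: h_def algebra_simps)
      also have "\<dots> = a * h y i"
        using sublinear_scale[OF p, of a "y + t *\<^sub>R s"] a by (simp add: h_def i algebra_simps)
      finally show ?thesis using a by (simp add: field_simps)
    qed
    then have "p' (a *\<^sub>R y) / a \<le> p' y" unfolding p'_def[of y] by (intro cINF_greatest I)
    then show ?thesis using a by (simp add: field_simps)
  qed
  have scale: "p' (a *\<^sub>R y) = a * p' y" if a: "0 \<le> a" for a y
  proof (cases "a = 0")
    case True
    have "p' 0 \<ge> 0"
      unfolding p'_def using lb[of _ 0] sublinear_0[OF p] by (intro cINF_greatest I) auto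
    then show ?thesis using True le_p[of 0] sublinear_0[OF p] by simp
  next
    case False
    then have "a > 0" using a by simp
    \<comment> \<open>The reverse inequality is the one just proved, applied with the factor
      1/a.\<close>
    then have "p' y \<le> (1 / a) * p' (a *\<^sub>R y)"
      using scale_le[of "1 / a" "a *\<^sub>R y"] by simp
    then have "a * p' y \<le> p' (a *\<^sub>R y)" using \<open>a > 0\<close> by (simp add: field_simps)
    then show ?thesis using scale_le[OF \<open>a > 0\<close>] by (simp add: antisym)
  qed
  have "p' (- s) \<le> - d" if "s \<in> S" for s
    using le[of "(1, s)" "- s"] that sublinear_0[OF p] by (simp add: I_def h_def)
  moreover have "sublinear p'" unfolding sublinear_def using add scale by blast
  ultimately show thesis using that le_p by blast
qed

text \<open>A minimal sublinear functional is linear, since lowering it at a single point shows that it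
  is odd.\<close>

theorem Hahn_Banach_sublinear:
  fixes p :: "'a::real_vector \<Rightarrow> real"
  assumes p: "sublinear p"
  obtains f where "linear f" "\<And>x. f x \<le> p x"
proof -
  define A where "A = {f. sublinear f \<and> (\<forall>x. f x \<le> p x)}"
  \<comment> \<open>The pointwise order is reversed, so the maximal element from Zorn's lemma is a
    minimal functional.\<close>
  define R where "R f g \<longleftrightarrow> (\<forall>x. g x \<le> f x)" for f g :: "'a \<Rightarrow> real"
  have "\<exists>m\<in>A. \<forall>f\<in>A. R m f \<longrightarrow> f = m"
  proof (rule predicate_Zorn)
    show "partial_order_on A (relation_of R A)"
      by (rule partial_order_on_relation_ofI)
        (auto simp: R_def intro!: ext intro: order_trans antisym)
    fix C assume C: "C \<in> Chains (relation_of R A)"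
    have CA: "C \<subseteq> A" using C by (auto simp: Chains_def relation_of_def)
    have tot: "R f g \<or> R g f" if "f \<in> C" "g \<in> C" for f g
      using C that by (auto simp: Chains_def relation_of_def)
    show "\<exists>u\<in>A. \<forall>f\<in>C. R f u"
    proof (cases "C = {}")
      case True
      then show ?thesis using p by (auto simp: A_def)
    next
      case False
      define u where "u x = (INF f\<in>C. f x)" for x
      have bdd: "bdd_below ((\<lambda>f. f x) ` C)" for x
      proof (rule bdd_belowI2)
        fix f assume "f \<in> C"
        then have "sublinear f" "f (- x) \<le> p (- x)" using CA by (auto simp: A_def)
        then show "- p (- x) \<le> f x" using sublinear_ge[of f x] by simp
      qed
      have le: "u x \<le> f x" if "f \<in> C" for f x
        unfolding u_def by (rule cINF_lower[OF bdd that])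
      have "u (x + y) \<le> u x + u y" for x y
      proof -
        have "u (x + y) \<le> f x + g y" if fg: "f \<in> C" "g \<in> C" for f g
        proof -
          \<comment> \<open>The smaller of the two members of the chain serves at both
            points.\<close>
          obtain k where k: "k \<in> C" "k x \<le> f x" "k y \<le> g y"
            using tot[OF fg] fg unfolding R_def by blast
          then have "k (x + y) \<le> k x + k y" using CA by (auto simp: A_def sublinear_add)
          then show ?thesis using le[OF k(1), of "x + y"] k by simp
        qed
        then show ?thesis
          using le_cINF_add[OF False False, of "u (x + y)" "\<lambda>f. f x" "\<lambda>f. f y"]
          unfolding u_def[of x] u_def[of y] by blast
      qed
      moreover have "u (a *\<^sub>R x) = a * u x" if a: "0 \<le> a" for a x
      proof -
        have "u (a *\<^sub>R x) = (INF f\<in>C. a * f x)"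
          unfolding u_def using CA a by (intro INF_cong) (auto simp: A_def sublinear_scale)
        also have "\<dots> = a * u x"
          unfolding u_def using a bdd False
          by (subst continuous_at_Inf_mono[of "(*) a" "(\<lambda>f. f x) ` C"])
            (auto simp: image_image mono_def mult_left_mono intro!: continuous_intros)
        finally show ?thesis .
      qed
      moreover have "u x \<le> p x" for x
      proof -
        obtain f where "f \<in> C" using False by auto
        then have "u x \<le> f x" "f x \<le> p x" using le CA by (auto simp: A_def)
        then show ?thesis by simp
      qed
      ultimately show ?thesis using le by (intro bexI[of _ u]) (auto simp: A_def R_def sublinear_def)
    qed
  qed
  then obtain m where m: "m \<in> A" "\<And>f. f \<in> A \<Longrightarrow> R m f \<Longrightarrow> f = m" by blast
  have sm: "sublinear m" and mp: "\<And>x. m x \<le> p x" using m by (auto simp: A_def)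
  have odd: "m (- y) = - m y" for y
  proof -
    obtain m' where m': "sublinear m'" "\<And>x. m' x \<le> m x" "m' (- y) \<le> - m y"
      by (rule sublinear_lowering[OF sm, of "{y}" "m y"]) auto
    have "m' = m"
      by (rule m) (use m' mp in \<open>auto simp: A_def R_def intro: order_trans\<close>)
    then show ?thesis using m' sublinear_ge[OF sm, of "- y"] by simp
  qed
  have "linear m"
  proof (rule linearI)
    show "m (x + y) = m x + m y" for x y
      using sublinear_add[OF sm, of x y] sublinear_add[OF sm, of "- x" "- y"] odd[of "x + y"]
      by (simp add: odd)
    show "m (a *\<^sub>R x) = a *\<^sub>R m x" for a x
    proof (cases "a \<ge> 0")
      case False
      then have "m ((- a) *\<^sub>R x) = - a * m x" by (intro sublinear_scale sm) simp
      then show ?thesis using odd[of "a *\<^sub>R x"] by simp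
    qed (use sublinear_scale[OF sm] in simp)
  qed
  then show thesis using that mp by blast
qed

corollary Hahn_Banach_convex:
  fixes p :: "'a::real_vector \<Rightarrow> real"
  assumes "sublinear p" "convex S" "S \<noteq> {}" "\<And>s. s \<in> S \<Longrightarrow> d \<le> p s"
  obtains f where "linear f" "\<And>x. f x \<le> p x" "\<And>s. s \<in> S \<Longrightarrow> d \<le> f s"
proof -
  obtain p' where p': "sublinear p'" "\<And>x. p' x \<le> p x" "\<And>s. s \<in> S \<Longrightarrow> p' (- s) \<le> - d"
    using sublinear_lowering[OF assms] by metis
  obtain f where f: "linear f" "\<And>x. f x \<le> p' x" using Hahn_Banach_sublinear[OF p'(1)] by blast
  show thesis
  proof
    show "f x \<le> p x" for x using f(2)[of x] p'(2)[of x] by simp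
    show "d \<le> f s" if "s \<in> S" for s
      using f(2)[of "- s"] p'(3)[OF that] linear_neg[OF f(1), of s] by simp
  qed fact
qed

text \<open>Applied with \<open>p\<close> the norm, for norming functionals and for Mazur's lemma,
  and with the partial l2 norms \<open>Q k\<close>, which are only dominated by a multiple of the
  norm.\<close>

lemma Hahn_Banach_bounded:
  fixes p :: "'a::real_normed_vector \<Rightarrow> real"
  assumes p: "sublinear p" "\<And>x. p x \<le> B * norm x"
    and S: "convex S" "S \<noteq> {}" "\<And>s. s \<in> S \<Longrightarrow> d \<le> p s"
  shows "\<exists>\<phi>. bounded_linear \<phi> \<and> (\<forall>x. \<phi> x \<le> p x) \<and> (\<forall>s\<in>S. d \<le> \<phi> s)"
proof -
  obtain \<phi> where \<phi>: "linear \<phi>" "\<And>x. \<phi> x \<le> p x" "\<And>s. s \<in> S \<Longrightarrow> d \<le> \<phi> s"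
    using Hahn_Banach_convex[OF p(1) S] by blast
  have "norm (\<phi> x) \<le> norm x * B" for x
  proof -
    have "\<phi> x \<le> B * norm x" "\<phi> (- x) \<le> B * norm x"
      using \<phi>(2)[of x] p(2)[of x] \<phi>(2)[of "- x"] p(2)[of "- x"] by auto
    then show ?thesis using linear_neg[OF \<phi>(1), of x] by (simp add: abs_le_iff mult.commute)
  qed
  then have "bounded_linear \<phi>"
    using \<phi>(1) by (intro bounded_linear_intro[of \<phi> B]) (auto simp: linear_add linear_cmul)
  then show ?thesis using \<phi> by blast
qed

lemma sublinear_norm: "sublinear norm"
  by (auto simp: sublinear_def norm_triangle_ineq)

lemma norming_functional:
  fixes x :: "'a::real_normed_vector"
  shows "\<exists>\<phi>. bounded_linear \<phi> \<and> (\<forall>y. \<phi> y \<le> norm y) \<and> \<phi> x = norm x"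
proof -
  obtain \<phi> where "bounded_linear \<phi>" "\<forall>y. \<phi> y \<le> norm y" "norm x \<le> \<phi> x"
    using Hahn_Banach_bounded[of norm 1 "{x}" "norm x"] sublinear_norm by auto
  then show ?thesis by (intro exI[of _ \<phi>]) (auto intro: antisym)
qed

section \<open>Ultrafilters and compactness\<close>

definition ultra :: "'a filter \<Rightarrow> bool" where
  "ultra F \<longleftrightarrow> F \<noteq> bot \<and> (\<forall>P. eventually P F \<or> eventually (\<lambda>x. \<not> P x) F)"

lemma ultra_not_eventually: "ultra F \<Longrightarrow> \<not> eventually P F \<Longrightarrow> eventually (\<lambda>x. \<not> P x) F"
  unfolding ultra_def by blast

lemma ultra_filtermap: "ultra F \<Longrightarrow> ultra (filtermap f F)"
  unfolding ultra_def by (auto simp: eventually_filtermap filtermap_bot_iff)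

text \<open>Zorn's lemma gives a minimal proper filter below \<open>F\<close>. Its meet with the
  principal filter of \<open>P\<close> is either \<open>bot\<close> or the filter itself, so it
  decides \<open>P\<close>.\<close>

lemma ultra_exists:
  fixes F :: "'a filter"
  assumes "F \<noteq> bot"
  obtains U where "ultra U" "U \<le> F"
proof -
  define A where "A = {G. G \<noteq> bot \<and> G \<le> F}"
  have "\<exists>U\<in>A. \<forall>G\<in>A. U \<ge> G \<longrightarrow> G = U"
  proof (rule predicate_Zorn)
    show "partial_order_on A (relation_of (\<ge>) A)"
      by (rule partial_order_on_relation_ofI) auto
    fix C assume C: "C \<in> Chains (relation_of (\<ge>) A)"
    have CA: "C \<subseteq> A" using C by (auto simp: Chains_def relation_of_def)
    have tot: "f \<le> g \<or> g \<le> f" if "f \<in> C" "g \<in> C" for f g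
      using C that by (auto simp: Chains_def relation_of_def)
    show "\<exists>u\<in>A. \<forall>f\<in>C. f \<ge> u"
    proof (cases "C = {}")
      case True
      then show ?thesis using assms by (auto simp: A_def)
    next
      case False
      \<comment> \<open>A chain is directed, so whatever holds eventually for the infimum already
        does so for some member.\<close>
      have "Inf C \<noteq> bot"
      proof
        assume "Inf C = bot"
        then have "eventually (\<lambda>_. False) (Inf C)" by simp
        then obtain G where "G \<in> C" "eventually (\<lambda>_. False) G"
          using eventually_Inf_base[OF False, of "\<lambda>_. False"] tot by (metis inf.absorb1 inf.absorb2 order_refl)
        then show False using CA by (auto simp: A_def trivial_limit_def)
      qed
      moreover have "Inf C \<le> F"
        using False CA by (auto simp: A_def intro: Inf_lower2)
      ultimately show ?thesis by (auto simp: A_def Inf_lower intro!: bexI[of _ "Inf C"])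
    qed
  qed
  then obtain U where U: "U \<noteq> bot" "U \<le> F" "\<And>G. G \<noteq> bot \<Longrightarrow> G \<le> U \<Longrightarrow> G = U"
    by (auto simp: A_def)
  have "ultra U"
    unfolding ultra_def
  proof (intro conjI allI)
    fix P
    show "eventually P U \<or> eventually (\<lambda>x. \<not> P x) U"
    proof (cases "inf U (principal {x. P x}) = bot")
      case True
      then have "eventually (\<lambda>_. False) (inf U (principal {x. P x}))" by simp
      then show ?thesis by (simp add: eventually_inf_principal)
    next
      case False
      then have "inf U (principal {x. P x}) = U" by (intro U) auto
      then have "U \<le> principal {x. P x}" by (metis inf.cobounded2)
      then have "eventually P U" by (simp add: le_principal)
      then show ?thesis ..
    qed
  qed fact
  then show thesis using that U by blast
qed

text \<open>Without a limit in \<open>K\<close>, the open sets that do not hold eventually would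
  cover \<open>K\<close>, and the ultrafilter would avoid all members of a finite subcover at
  once.\<close>

lemma compactin_ultra_limit:
  assumes K: "compactin X K" and F: "ultra F" "eventually (\<lambda>x. x \<in> K) F"
  shows "\<exists>l\<in>K. \<forall>V. openin X V \<and> l \<in> V \<longrightarrow> eventually (\<lambda>x. x \<in> V) F"
proof (rule ccontr)
  assume no: "\<not> ?thesis"
  define \<U> where "\<U> = {V. openin X V \<and> \<not> eventually (\<lambda>x. x \<in> V) F}"
  have "K \<subseteq> \<Union>\<U>" using no by (auto simp: \<U>_def)
  moreover have "\<forall>V\<in>\<U>. openin X V" by (simp add: \<U>_def)
  ultimately obtain \<F> where \<F>: "finite \<F>" "\<F> \<subseteq> \<U>" "K \<subseteq> \<Union>\<F>"
    using K unfolding compactin_def by meson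
  have "eventually (\<lambda>x. \<forall>V\<in>\<F>. x \<notin> V) F"
    using \<F> ultra_not_eventually[OF F(1)] by (auto simp: eventually_ball_finite_distrib \<U>_def)
  then have "eventually (\<lambda>_. False) F"
    using F(2) by eventually_elim (use \<F> in auto)
  then show False using F(1) by (auto simp: ultra_def trivial_limit_def)
qed

text \<open>If a cover has no finite subcover, the sets \<open>S - V\<close> generate a proper
  filter. An ultrafilter below it has a limit in some \<open>V\<close> of the cover, yet contains
  \<open>S - V\<close>.\<close>

lemma compactin_ultraI:
  assumes S: "S \<subseteq> topspace X"
    and lim: "\<And>F. ultra F \<Longrightarrow> eventually (\<lambda>x. x \<in> S) F \<Longrightarrow>
      \<exists>l\<in>S. \<forall>V. openin X V \<and> l \<in> V \<longrightarrow> eventually (\<lambda>x. x \<in> V) F"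
  shows "compactin X S"
  unfolding compactin_def
proof (intro conjI allI impI S)
  fix \<U> assume \<U>: "(\<forall>U\<in>\<U>. openin X U) \<and> S \<subseteq> \<Union> \<U>"
  show "\<exists>\<F>. finite \<F> \<and> \<F> \<subseteq> \<U> \<and> S \<subseteq> \<Union> \<F>"
  proof (rule ccontr)
    assume no: "\<not> ?thesis"
    \<comment> \<open>Inserting the empty set puts \<open>S\<close> itself into the filter.\<close>
    define G where "G = (INF V\<in>insert {} \<U>. principal (S - V))"
    have "G \<noteq> bot"
      unfolding G_def
    proof (rule INF_filter_not_bot)
      fix Y assume Y: "Y \<subseteq> insert {} \<U>" "finite Y"
      have "\<not> S \<subseteq> \<Union>(Y - {{}})" using Y no by (metis Diff_subset_conv finite_Diff insert_is_Un)
      then obtain x where "x \<in> S" "x \<notin> \<Union>Y" by auto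
      then have "principal {x} \<le> (INF V\<in>Y. principal (S - V))"
        by (intro INF_greatest) auto
      then show "(INF V\<in>Y. principal (S - V)) \<noteq> bot"
        by (metis bot.extremum_uniqueI insert_not_empty principal_eq_bot_iff)
    qed
    then obtain F where F: "ultra F" "F \<le> G" using ultra_exists by blast
    have ev: "eventually (\<lambda>x. x \<in> S - V) F" if "V \<in> insert {} \<U>" for V
    proof -
      have "F \<le> principal (S - V)" using F(2) that unfolding G_def by (meson INF_lower order_trans)
      then show ?thesis by (simp add: le_principal)
    qed
    have "eventually (\<lambda>x. x \<in> S) F" using ev[of "{}"] by simp
    then obtain l where l: "l \<in> S" "\<And>V. openin X V \<Longrightarrow> l \<in> V \<Longrightarrow> eventually (\<lambda>x. x \<in> V) F"
      using lim[OF F(1)] by blast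
    then obtain V where V: "V \<in> \<U>" "l \<in> V" using \<U> by auto
    then have "eventually (\<lambda>x. x \<in> V) F" "eventually (\<lambda>x. x \<in> S - V) F"
      using l \<U> ev by auto
    then have "eventually (\<lambda>_. False) F" by eventually_elim auto
    then show False using F(1) by (auto simp: ultra_def trivial_limit_def)
  qed
qed

section \<open>The weak topology of an abstract space\<close>

lemma operator_zero: "operator W (type_sp :: real nspace) (\<lambda>_. 0)"
  unfolding operator_def type_sp_def by (auto intro: exI[of _ 0])

lemma topspace_weak_top: "topspace (weak_top W) = carrier W"
proof -
  have "carrier W \<inter> (\<lambda>_. 0::real) -` UNIV \<in>
      {carrier W \<inter> \<phi> -` U | \<phi> U. operator W (type_sp :: real nspace) \<phi> \<and> open U}"
    using operator_zero by blast
  then show ?thesis unfolding weak_top_def topology_generated_by_topspace by blast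
qed

lemma openin_weak_top_vimage:
  "operator W (type_sp :: real nspace) \<phi> \<Longrightarrow> open U \<Longrightarrow> openin (weak_top W) (carrier W \<inter> \<phi> -` U)"
  unfolding weak_top_def by (rule topology_generated_by_Basis) blast

text \<open>Induction over the generation of open sets leaves only the subbasic ones, where the
  claim is convergence of a single functional.\<close>

lemma weak_top_eventuallyI:
  assumes F: "eventually (\<lambda>s. s \<in> carrier W) F"
    and lim: "\<And>\<phi>. operator W (type_sp :: real nspace) \<phi> \<Longrightarrow> (\<phi> \<longlongrightarrow> \<phi> l) F"
    and V: "openin (weak_top W) V" "l \<in> V"
  shows "eventually (\<lambda>s. s \<in> V) F"
proof -
  have "generate_topology_on {carrier W \<inter> \<phi> -` U | \<phi> U. operator W (type_sp :: real nspace) \<phi> \<and> open U} V"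
    using V(1) unfolding weak_top_def by (rule openin_topology_generated_by)
  then show ?thesis using V(2)
  proof induction
    case (Int a b)
    then show ?case by (auto elim: eventually_elim2)
  next
    case (UN K)
    then obtain k where "k \<in> K" "l \<in> k" by blast
    then show ?case using UN.IH[of k] by (auto elim: eventually_mono)
  next
    case (Basis V)
    then obtain \<phi> U where \<phi>: "V = carrier W \<inter> \<phi> -` U" "operator W (type_sp :: real nspace) \<phi>" "open U"
      by blast
    then have "eventually (\<lambda>s. \<phi> s \<in> U) F"
      using topological_tendstoD[OF lim[OF \<phi>(2)] \<phi>(3)] Basis by simp
    then show ?case using F by eventually_elim (simp add: \<phi>)
  qed simp
qed

section \<open>Subsequences with an upper l2 estimate\<close>

lemma ultra_tendsto_bounded:
  fixes g :: "'a \<Rightarrow> real"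
  assumes U: "ultra U" and g: "\<And>i. a \<le> g i" "\<And>i. g i \<le> b"
  obtains l where "(g \<longlongrightarrow> l) U"
proof -
  have "\<exists>l\<in>{a..b}. \<forall>V. openin euclidean V \<and> l \<in> V \<longrightarrow> eventually (\<lambda>x. x \<in> V) (filtermap g U)"
    by (rule compactin_ultra_limit) (use U g in \<open>auto intro: ultra_filtermap simp: eventually_filtermap\<close>)
  then obtain l where "\<And>V. open V \<Longrightarrow> l \<in> V \<Longrightarrow> eventually (\<lambda>x. g x \<in> V) U"
    by (auto simp: eventually_filtermap)
  then show thesis using that topological_tendstoI by blast
qed

text \<open>The terms are chosen one after another: each of the finitely many earlier terms imposes
  a condition that holds eventually along \<open>U\<close>. Since \<open>U\<close> refines
  \<open>sequentially\<close>, being larger than the earlier terms is such a condition too.\<close>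

lemma eventually_pairs_subseq:
  assumes U: "U \<noteq> bot" "U \<le> sequentially" and P: "\<And>i. eventually (P i) U"
  obtains r :: "nat \<Rightarrow> nat" where "strict_mono r" "\<And>i j. i < j \<Longrightarrow> P (r i) (r j)"
proof -
  have "\<exists>f. \<forall>n::nat. \<forall>k<n. f k < f n \<and> P (f k) (f n)"
  proof (rule dependent_wf_choice[OF wf_less_than, where P = "\<lambda>f n x. \<forall>k<n. f k < x \<and> P (f k) x"])
    fix n and f :: "nat \<Rightarrow> nat"
    have "eventually (\<lambda>x. k < x \<and> P k x) U" for k
      using filter_leD[OF U(2) eventually_gt_at_top[of k]] P[of k] by eventually_elim auto
    then have "eventually (\<lambda>x. \<forall>k\<in>{..<n}. f k < x \<and> P (f k) x) U"
      by (auto simp: eventually_ball_finite_distrib)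
    from eventually_happens'[OF U(1) this] show "\<exists>x. \<forall>k<n. f k < x \<and> P (f k) x"
      by (simp add: lessThan_def)
  qed auto
  then obtain f where "\<forall>n::nat. \<forall>k<n. f k < f n \<and> P (f k) (f n)" ..
  then show thesis using that[of f] by (auto simp: strict_mono_def)
qed

lemma L2_set_subset_mono: "finite B \<Longrightarrow> A \<subseteq> B \<Longrightarrow> L2_set f A \<le> L2_set f B"
  unfolding L2_set_def by (intro real_sqrt_le_mono sum_mono2) auto

lemma L2_set_bounded_tail:
  fixes f :: "nat \<Rightarrow> real"
  assumes M: "\<And>k. L2_set f {..<k} \<le> M" and "0 < e"
  obtains p where "\<And>k. L2_set f {p..<k} \<le> e"
proof -
  have "summable (\<lambda>n. (f n)\<^sup>2)"
  proof (rule summableI_nonneg_bounded)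
    show "(\<Sum>n<k. (f n)\<^sup>2) \<le> M\<^sup>2" for k
      using M[of k] by (simp add: L2_set_def sqrt_le_D)
  qed auto
  then obtain p where "\<And>k. norm (\<Sum>n\<in>{p..<k}. (f n)\<^sup>2) < e\<^sup>2"
    unfolding summable_Cauchy using \<open>0 < e\<close> by (meson order_refl zero_less_power)
  then have "L2_set f {p..<k} \<le> e" for k
    unfolding L2_set_def using \<open>0 < e\<close> by (intro real_le_lsqrt) (auto simp: sum_nonneg less_imp_le)
  then show thesis using that by blast
qed

lemma sum_mult_le_L2_set:
  fixes f g :: "'a \<Rightarrow> real"
  shows "(\<Sum>n\<in>A. f n * g n) \<le> L2_set f A * L2_set g A"
proof -
  have "(\<Sum>n\<in>A. f n * g n) \<le> (\<Sum>n\<in>A. \<bar>f n\<bar> * \<bar>g n\<bar>)"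
    by (intro sum_mono) (metis abs_ge_self abs_mult)
  then show ?thesis using L2_set_mult_ineq[of f g A] by linarith
qed

text \<open>If the f i converge pointwise to g along the ultrafilter, then for fixed i the inner
  product of f i and f j over a far tail is close to that of f i and g, which the tail of g
  controls uniformly in i.\<close>

lemma eventually_small_tail_products:
  fixes f :: "nat \<Rightarrow> nat \<Rightarrow> real"
  assumes U: "ultra U" and pos: "\<And>i n. 0 \<le> f i n"
    and M: "\<And>i k. L2_set (f i) {..<k} \<le> M" and e: "0 < e"
  shows "\<exists>p. \<forall>i. eventually (\<lambda>j. \<forall>k. (\<Sum>n\<in>{p..<k}. f i n * f j n) \<le> e) U"
proof -
  have U0: "U \<noteq> bot" using U by (simp add: ultra_def)
  have M0: "0 \<le> M" using M[of 0 0] by simp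
  have fM: "f i n \<le> M" for i n
    using member_le_L2_set[of "{..<Suc n}" n "f i"] M[of i "Suc n"] by simp
  have "\<exists>l. ((\<lambda>i. f i n) \<longlongrightarrow> l) U" for n
    by (rule ultra_tendsto_bounded[OF U, of 0 "\<lambda>i. f i n" M]) (use pos fM in auto)
  then obtain g where g: "\<And>n. ((\<lambda>i. f i n) \<longlongrightarrow> g n) U" by metis
  have "L2_set g {..<k} \<le> M" for k
  proof (rule tendsto_upperbound[OF _ _ U0])
    show "((\<lambda>i. L2_set (f i) {..<k}) \<longlongrightarrow> L2_set g {..<k}) U"
      unfolding L2_set_def by (intro tendsto_intros g)
  qed (use M in auto)
  \<comment> \<open>The product M * h is at most e/4, small enough for both pieces of the sum;
    adding 1 keeps the quotient defined when M = 0.\<close>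
  define h where "h = e / (4 * (M + 1))"
  have h: "0 < h" "M * h \<le> e / 4"
    using M0 e by (auto simp: h_def field_simps)
  obtain p where p: "\<And>k. L2_set g {p..<k} \<le> h"
    using L2_set_bounded_tail[OF \<open>\<And>k. L2_set g {..<k} \<le> M\<close> h(1)] by blast
  have tail: "L2_set (f i) {a..<b} \<le> M" for i a b
    by (rule order_trans[OF L2_set_subset_mono M[of i b]]) auto
  have "eventually (\<lambda>j. \<forall>k. (\<Sum>n\<in>{p..<k}. f i n * f j n) \<le> e) U" for i
  proof -
    \<comment> \<open>The cut \<open>P\<close> may depend on \<open>i\<close>, while
      \<open>p\<close> may not. Between them finitely many coordinates of \<open>f j\<close>
      converge to those of \<open>g\<close>; beyond \<open>P\<close> the tail of \<open>f i\<close>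
      itself is small.\<close>
    obtain P where P: "\<And>k. L2_set (f i) {P..<k} \<le> h"
      using L2_set_bounded_tail[OF M h(1)] by blast
    have "(\<Sum>n\<in>{p..<P}. f i n * g n) \<le> L2_set (f i) {p..<P} * L2_set g {p..<P}"
      by (rule sum_mult_le_L2_set)
    also have "\<dots> \<le> M * h" by (intro mult_mono tail p M0 L2_set_nonneg)
    also have "\<dots> < e / 2" using h e by simp
    finally have "eventually (\<lambda>j. (\<Sum>n\<in>{p..<P}. f i n * f j n) < e / 2) U"
      by (intro order_tendstoD(2)[of _ "\<Sum>n\<in>{p..<P}. f i n * g n"] tendsto_intros g)
    then show ?thesis
    proof eventually_elim
      case (elim j)
      show ?case
      proof
        fix k
        have "(\<Sum>n\<in>{p..<k}. f i n * f j n) \<le> (\<Sum>n\<in>{p..<P} \<union> {P..<k}. f i n * f j n)"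
          by (intro sum_mono2) (auto simp: pos)
        also have "\<dots> = (\<Sum>n\<in>{p..<P}. f i n * f j n) + (\<Sum>n\<in>{P..<k}. f i n * f j n)"
          by (intro sum.union_disjoint) auto
        also have "(\<Sum>n\<in>{P..<k}. f i n * f j n) \<le> L2_set (f i) {P..<k} * L2_set (f j) {P..<k}"
          by (rule sum_mult_le_L2_set)
        also have "\<dots> \<le> h * M" by (intro mult_mono tail P) (use h in auto)
        also have "\<dots> \<le> e / 2" using h e by (simp add: mult.commute)
        finally show "(\<Sum>n\<in>{p..<k}. f i n * f j n) \<le> e" using elim by simp
      qed
    qed
  qed
  then show ?thesis by blast
qed

text \<open>The squared l2 norm expands into the Gram matrix of the tails. Its diagonal is bounded
  by M^2 and yields the l2 norm of \<open>c\<close>; along \<open>r\<close> the other entries are at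
  most e^2 and yield the l1 norm. The tail lemma is used with e^2 because a square root is taken at
  the end.\<close>

lemma L2_bounded_subseq_tail_estimate:
  fixes f :: "nat \<Rightarrow> nat \<Rightarrow> real"
  assumes pos: "\<And>i n. 0 \<le> f i n" and M: "\<And>i k. L2_set (f i) {..<k} \<le> M" and e: "0 < e"
  shows "\<exists>(r :: nat \<Rightarrow> nat) p. strict_mono r \<and> (\<forall>F c k. finite F \<longrightarrow> (\<forall>i. 0 \<le> c i) \<longrightarrow>
      L2_set (\<lambda>n. \<Sum>i\<in>F. c i * f (r i) n) {p..<k} \<le> e * sum c F + M * L2_set c F)"
proof -
  have M0: "0 \<le> M" using M[of 0 0] by simp
  obtain U :: "nat filter" where U: "ultra U" "U \<le> sequentially"
    using ultra_exists[of sequentially] by auto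
  obtain p where "\<And>i. eventually (\<lambda>j. \<forall>k. (\<Sum>n\<in>{p..<k}. f i n * f j n) \<le> e\<^sup>2) U"
    using eventually_small_tail_products[of U f M "e\<^sup>2", OF U(1) pos M] e by auto
  then obtain r :: "nat \<Rightarrow> nat" where r: "strict_mono r"
    and rp: "\<And>i j. i < j \<Longrightarrow> \<forall>k. (\<Sum>n\<in>{p..<k}. f (r i) n * f (r j) n) \<le> e\<^sup>2"
    using eventually_pairs_subseq[OF _ U(2), of "\<lambda>i j. \<forall>k. (\<Sum>n\<in>{p..<k}. f i n * f j n) \<le> e\<^sup>2"] U(1)
    unfolding ultra_def by blast
  have main: "L2_set (\<lambda>n. \<Sum>i\<in>F. c i * f (r i) n) {p..<k} \<le> e * sum c F + M * L2_set c F"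
    if F: "finite F" and c: "\<And>i. 0 \<le> c i" for F c k
  proof -
    define G where "G i j = (\<Sum>n\<in>{p..<k}. f (r i) n * f (r j) n)" for i j
    \<comment> \<open>Allowing e^2 on the diagonal as well lets the e^2 terms sum to the full square
      of \<open>sum c F\<close>.\<close>
    have G: "G i j \<le> (if i = j then M\<^sup>2 else 0) + e\<^sup>2" for i j
    proof (cases "i = j")
      case True
      have "L2_set (f (r i)) {p..<k} \<le> L2_set (f (r i)) {..<k}"
        by (intro L2_set_subset_mono) auto
      then have "L2_set (f (r i)) {p..<k} \<le> M" using M[of "r i" k] by linarith
      then have "(L2_set (f (r i)) {p..<k})\<^sup>2 \<le> M\<^sup>2" by (intro power_mono) auto
      then have "G i i \<le> M\<^sup>2" by (simp add: G_def L2_set_def sum_nonneg power2_eq_square)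
      then show ?thesis using True by (simp add: add_increasing2)
    next
      case False
      have "G i j = G j i" by (simp add: G_def mult.commute)
      then have "G i j \<le> e\<^sup>2" using rp[of i j] rp[of j i] False
        unfolding G_def by (metis linorder_neqE_nat)
      then show ?thesis using False by simp
    qed
    have "(\<Sum>n\<in>{p..<k}. (\<Sum>i\<in>F. c i * f (r i) n)\<^sup>2)
        = (\<Sum>n\<in>{p..<k}. \<Sum>i\<in>F. \<Sum>j\<in>F. c i * c j * (f (r i) n * f (r j) n))"
      by (simp add: power2_eq_square sum_product mult_ac)
    also have "\<dots> = (\<Sum>i\<in>F. \<Sum>n\<in>{p..<k}. \<Sum>j\<in>F. c i * c j * (f (r i) n * f (r j) n))"
      by (rule sum.swap)
    also have "\<dots> = (\<Sum>i\<in>F. \<Sum>j\<in>F. c i * c j * G i j)"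
      unfolding G_def sum_distrib_left by (intro sum.cong refl sum.swap)
    also have "\<dots> \<le> (\<Sum>i\<in>F. \<Sum>j\<in>F. c i * c j * ((if i = j then M\<^sup>2 else 0) + e\<^sup>2))"
      by (intro sum_mono mult_left_mono G mult_nonneg_nonneg c)
    also have "\<dots> = (\<Sum>i\<in>F. \<Sum>j\<in>F. if i = j then M\<^sup>2 * (c i)\<^sup>2 else 0) + (\<Sum>i\<in>F. \<Sum>j\<in>F. e\<^sup>2 * (c i * c j))"
      unfolding sum.distrib[symmetric]
      by (intro sum.cong refl) (auto simp: algebra_simps power2_eq_square)
    also have "\<dots> = M\<^sup>2 * (\<Sum>i\<in>F. (c i)\<^sup>2) + e\<^sup>2 * (sum c F)\<^sup>2"
    proof -
      have "(\<Sum>i\<in>F. \<Sum>j\<in>F. e\<^sup>2 * (c i * c j)) = e\<^sup>2 * (sum c F)\<^sup>2"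
        unfolding power2_eq_square[of "sum c F"] sum_product by (simp only: sum_distrib_left)
      then show ?thesis using F by (simp add: sum.delta sum_distrib_left)
    qed
    finally have "L2_set (\<lambda>n. \<Sum>i\<in>F. c i * f (r i) n) {p..<k}
        \<le> sqrt (M\<^sup>2 * (\<Sum>i\<in>F. (c i)\<^sup>2) + e\<^sup>2 * (sum c F)\<^sup>2)"
      unfolding L2_set_def by (rule real_sqrt_le_mono)
    also have "\<dots> \<le> sqrt (M\<^sup>2 * (\<Sum>i\<in>F. (c i)\<^sup>2)) + sqrt (e\<^sup>2 * (sum c F)\<^sup>2)"
      by (intro sqrt_add_le_add_sqrt) (auto simp: sum_nonneg)
    also have "\<dots> = M * L2_set c F + e * sum c F"
      using M0 e c by (simp add: L2_set_def real_sqrt_mult sum_nonneg)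
    finally show ?thesis by simp
  qed
  then show ?thesis using r by blast
qed

section \<open>Schreier families\<close>

lemma schreier_finite: "E \<in> schreier \<xi> \<Longrightarrow> finite E \<and> E \<subseteq> {1..}"
  by (induction \<xi> arbitrary: E) (fastforce simp del: atLeast_iff)+

lemma Max_less_Min_iff:
  fixes A B :: "nat set"
  assumes "finite A" "A \<noteq> {}" "finite B" "B \<noteq> {}"
  shows "Max A < Min B \<longleftrightarrow> (\<forall>a\<in>A. \<forall>b\<in>B. a < b)"
  using assms by auto

text \<open>The families are spreading: a \<le> r a, so minima do not drop, and the order of the
  pieces is kept. This allows passing to subsequences of a spreading model.\<close>

lemma schreier_image_strict_mono:
  assumes r: "strict_mono (r :: nat \<Rightarrow> nat)"
  shows "E \<in> schreier \<xi> \<Longrightarrow> r ` E \<in> schreier \<xi>"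
proof (induction \<xi> arbitrary: E)
  case OZero
  have "1 \<le> r a" if "1 \<le> a" for a using strict_mono_imp_increasing[OF r, of a] that by linarith
  then have "r ` E \<subseteq> {1..}" using OZero by auto
  then show ?case using OZero card_image_le[of E r] by simp
next
  case (OSucc x)
  then obtain n F where F: "1 \<le> n" "\<And>i. i < n \<Longrightarrow> F i \<noteq> {} \<and> F i \<in> schreier x"
    "\<And>i. Suc i < n \<Longrightarrow> Max (F i) < Min (F (Suc i))" "n \<le> Min (F 0)" "E = (\<Union>i<n. F i)"
    by auto
  have fin: "finite (F i)" "F i \<noteq> {}" if "i < n" for i using F(2)[OF that] schreier_finite by auto
  have "Max (r ` F i) < Min (r ` F (Suc i))" if i: "Suc i < n" for i
    using F(3)[OF i] fin[of i] fin[of "Suc i"] i r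
    by (subst Max_less_Min_iff) (auto simp: Max_less_Min_iff strict_mono_less)
  moreover have "n \<le> Min (r ` F 0)"
  proof -
    have "n \<le> r a" if "a \<in> F 0" for a
      using strict_mono_imp_increasing[OF r, of a] fin[of 0] F(1,4) Min_le[of "F 0" a] that by linarith
    then show ?thesis using F(1) fin[of 0] by simp
  qed
  ultimately show ?case
    using F OSucc.IH by (auto intro!: exI[of _ n] exI[of _ "\<lambda>i. r ` F i"])
next
  case (OLim f)
  then obtain n where n: "E = {} \<or> Suc n \<le> Min E" "E \<in> schreier (f n)" by auto
  have "Suc n \<le> Min (r ` E)" if "E \<noteq> {}"
  proof -
    have "Suc n \<le> r a" if "a \<in> E" for a
      using strict_mono_imp_increasing[OF r, of a] n schreier_finite[OF n(2)] Min_le[of E a] that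
      by (metis empty_iff le_trans)
    then show ?thesis using schreier_finite[OF n(2)] that by simp
  qed
  then show ?case using n OLim.IH[of "f n" E] by auto
qed

lemma schreier_singleton: "1 \<le> j \<Longrightarrow> {j} \<in> schreier \<xi>"
proof (induction \<xi>)
  case (OSucc x)
  then show ?case by (auto intro!: exI[of _ 1] exI[of _ "\<lambda>_. {j}"])
qed (auto intro: exI[of _ 0])

lemma ord_wf_OSuccD: "ord_wf (OSucc x) \<Longrightarrow> ord_wf x"
  by (erule ord_wf.cases) auto

text \<open>No rule of \<open>ord_le\<close> puts a successor below \<open>OZero\<close>, so only
  the first term of a fundamental sequence can be \<open>OZero\<close>.\<close>

lemma ord_wf_OLimD:
  assumes "ord_wf (OLim f)" shows "ord_wf (f n)" "f (Suc n) \<noteq> OZero"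
proof -
  have *: "\<And>n. ord_wf (f n) \<and> ord_less (f n) (f (Suc n))"
    using assms by cases auto
  then show "ord_wf (f n)" by blast
  have "ord_le (OSucc (f n)) (f (Suc n))" using * by (simp add: ord_less_def)
  then show "f (Suc n) \<noteq> OZero" by cases auto
qed

text \<open>This places S_1 inside every family of nonzero index. It starts the induction for block
  blow-ups, since S_0 is not stable under them. At level one the set is cut into singletons; at a
  higher successor one piece is enough.\<close>

lemma card_le_Min_imp_schreier:
  assumes "ord_wf \<xi>" "\<xi> \<noteq> OZero" "finite E" "E \<noteq> {}" "card E \<le> Min E"
  shows "E \<in> schreier \<xi>"
  using assms
proof (induction \<xi> arbitrary: E rule: ordn.induct)
  case (OSucc x)
  have E1: "1 \<le> Min E"
    using OSucc.prems by (metis One_nat_def Suc_leI card_gt_0_iff le_trans)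
  show ?case
  proof (cases "x = OZero")
    case True
    define l where "l = sorted_list_of_set E"
    have l: "length l = card E" "set l = E" "sorted_wrt (<) l"
      using OSucc.prems by (auto simp: l_def)
    have n: "1 \<le> card E" using OSucc.prems by (simp add: Suc_leI card_gt_0_iff)
    have mem: "Min E \<le> l ! i" if "i < card E" for i
      using l that OSucc.prems by (metis Min_le nth_mem)
    have U: "E = (\<Union>i<card E. {l ! i})"
      using l by (auto simp: set_conv_nth)
    have lt: "l ! i < l ! Suc i" if "Suc i < card E" for i
      using sorted_wrt_nth_less[OF l(3), of i "Suc i"] that l(1) by simp
    have m0: "card E \<le> l ! 0" using mem[of 0] n OSucc.prems by linarith
    have m1: "Suc 0 \<le> l ! i" if "i < card E" for i using mem[OF that] E1 by linarith
    show ?thesis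
      unfolding True schreier.simps mem_Collect_eq
      using n m0 m1 lt U by (intro exI[of _ "card E"] exI[of _ "\<lambda>i. {l ! i}"]) auto
  next
    case False
    then have "E \<in> schreier x" using OSucc ord_wf_OSuccD by blast
    then show ?thesis
      unfolding schreier.simps mem_Collect_eq
      using E1 OSucc.prems(4) by (intro exI[of _ 1] exI[of _ "\<lambda>_. E"]) (simp add: lessThan_Suc)
  qed
next
  case (OLim f)
  show ?case
  \<comment> \<open>The term \<open>f 0\<close> may be zero, so \<open>f 1\<close> is used, whose
    admissibility condition is 2 \<le> Min E. Otherwise the bound on the cardinality forces E =
    {1}.\<close>
  proof (cases "Min E \<ge> 2")
    case True
    have "E \<in> schreier (f 1)"
      using OLim ord_wf_OLimD[OF OLim.prems(1), of 0] ord_wf_OLimD[OF OLim.prems(1), of 1] by auto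
    then show ?thesis using True by (auto intro!: exI[of _ 1])
  next
    case False
    moreover have "card E > 0" using OLim.prems by (simp add: card_gt_0_iff)
    ultimately have "card E = 1" "Min E = 1" using OLim.prems by linarith+
    then have "E = {1}" by (auto simp: card_1_singleton_iff)
    then show ?thesis using schreier_singleton[of 1] by simp
  qed
qed auto

section \<open>Blowing up the points of a Schreier set to blocks of length m\<close>

lemma div_eq_interval: "0 < (m::nat) \<Longrightarrow> {i. i div m = j} = {j * m..<j * m + m}"
  using dividend_less_times_div[of m]
  by (auto simp: div_nat_eqI algebra_simps intro: div_nat_eqI)

lemma finite_div_vimage: "finite F \<Longrightarrow> 0 < (m::nat) \<Longrightarrow> finite {i. i div m \<in> F}"
proof -
  assume "finite F" "0 < m"
  have "{i. i div m \<in> F} = (\<Union>j\<in>F. {i. i div m = j})" by auto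
  then show ?thesis using \<open>finite F\<close> \<open>0 < m\<close> by (simp add: div_eq_interval)
qed

lemma card_div_vimage:
  assumes "finite F" "0 < (m::nat)"
  shows "card {i. i div m \<in> F} = m * card F"
proof -
  have "{i. i div m \<in> F} = (\<Union>j\<in>F. {i. i div m = j})" by auto
  also have "card \<dots> = (\<Sum>j\<in>F. card {i. i div m = j})"
    by (intro card_UN_disjoint) (use assms in \<open>simp_all add: div_eq_interval[of m, symmetric] finite_div_vimage[of "{_}", simplified]\<close>, auto)
  finally show ?thesis using assms by (simp add: div_eq_interval)
qed

lemma Min_div_vimage:
  assumes "finite F" "F \<noteq> {}" "0 < (m::nat)"
  shows "{i. i div m \<in> F} \<noteq> {}" "m * Min F \<le> Min {i. i div m \<in> F}"
proof -
  obtain j where "j \<in> F" using assms by auto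
  then have "j * m \<in> {i. i div m \<in> F}" using assms by simp
  then show ne: "{i. i div m \<in> F} \<noteq> {}" by blast
  have "m * Min F \<le> i" if "i div m \<in> F" for i
    using mult_le_mono2[OF Min_le[OF assms(1) that], of m] times_div_less_eq_dividend[of m i]
    by linarith
  then show "m * Min F \<le> Min {i. i div m \<in> F}"
    using ne finite_div_vimage[OF assms(1,3)] by simp
qed

text \<open>Each of the \<open>n\<close> pieces is a single point, so \<open>n\<close> bounds the
  cardinality, and the order of the pieces carries the bound n \<le> Min (G 0) to all of them. As n
  \<ge> 1 and the pieces are nonempty, the empty set is excluded.\<close>

lemma schreier_one_card_le_Min:
  assumes "F \<in> schreier (OSucc OZero)"
  shows "finite F" "F \<noteq> {}" "card F \<le> Min F"
proof -
  obtain n G where G: "1 \<le> n" "\<And>i. i < n \<Longrightarrow> G i \<noteq> {} \<and> G i \<in> schreier OZero"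
    "\<And>i. Suc i < n \<Longrightarrow> Max (G i) < Min (G (Suc i))" "n \<le> Min (G 0)" "F = (\<Union>i<n. G i)"
    using assms unfolding schreier.simps(2)[of OZero] by blast
  have fin: "finite (G i)" "G i \<noteq> {}" "card (G i) \<le> 1" if "i < n" for i using G(2)[OF that] by auto
  show F: "finite F" "F \<noteq> {}" using G(1,5) fin[of 0] fin(1) by auto
  have "card F \<le> (\<Sum>i<n. card (G i))" unfolding G(5) by (rule card_UN_le) simp
  also have "\<dots> \<le> (\<Sum>i<n. 1)" by (intro sum_mono fin) auto
  also have "\<dots> = n" by simp
  finally have "card F \<le> n" .
  moreover have "\<forall>a\<in>G i. n \<le> a" if "i < n" for i
    using that
  proof (induction i)
    case 0
    then show ?case using G(4) fin[of 0] by auto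
  next
    case (Suc i)
    have "Max (G i) \<in> G i" using fin[of i] Suc.prems by simp
    then have "n \<le> Max (G i)" using Suc by simp
    then show ?case
      using G(3)[OF Suc.prems] fin[of "Suc i"] Suc.prems
      by (metis Min_le le_trans less_imp_le)
  qed
  then have "n \<le> Min F" using F G(5) by auto
  ultimately show "card F \<le> Min F" by simp
qed

text \<open>Replacing each point j by the block {j * m..<j * m + m} multiplies the cardinality by m,
  but the minimum grows by at least the same factor, so S_1 is preserved. Higher successors follow
  piecewise, because blocks of ordered sets are ordered.\<close>

lemma schreier_div_vimage:
  assumes "ord_wf \<xi>" "\<xi> \<noteq> OZero" "2 \<le> (m::nat)" "F \<in> schreier \<xi>"
  shows "{i. i div m \<in> F} \<in> schreier \<xi>"
  using assms
proof (induction \<xi> arbitrary: F rule: ordn.induct)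
  case (OSucc x)
  have m: "0 < m" using OSucc.prems by simp
  show ?case
  proof (cases "x = OZero")
    case True
    then have F: "finite F" "F \<noteq> {}" "card F \<le> Min F"
      using schreier_one_card_le_Min[of F] OSucc.prems(4) by auto
    have "card {i. i div m \<in> F} = m * card F" by (rule card_div_vimage[OF F(1) m])
    also have "\<dots> \<le> m * Min F" using F(3) by simp
    also have "\<dots> \<le> Min {i. i div m \<in> F}" by (rule Min_div_vimage(2)[OF F(1,2) m])
    finally show ?thesis
      by (intro card_le_Min_imp_schreier OSucc.prems finite_div_vimage Min_div_vimage F m)
  next
    case False
    obtain n G where G: "1 \<le> n" "\<And>i. i < n \<Longrightarrow> G i \<noteq> {} \<and> G i \<in> schreier x"
      "\<And>i. Suc i < n \<Longrightarrow> Max (G i) < Min (G (Suc i))" "n \<le> Min (G 0)" "F = (\<Union>i<n. G i)"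
      using OSucc.prems(4) by auto
    define H where "H j = {i. i div m \<in> G j}" for j
    have fin: "finite (G i)" "G i \<noteq> {}" if "i < n" for i using G(2)[OF that] schreier_finite by auto
    have finH: "finite (H i)" "H i \<noteq> {}" if "i < n" for i
      unfolding H_def using finite_div_vimage Min_div_vimage fin[OF that] m by auto
    have HS: "H i \<in> schreier x" if "i < n" for i
      unfolding H_def using OSucc False G(2)[OF that] ord_wf_OSuccD by blast
    have lt: "Max (H i) < Min (H (Suc i))" if i: "Suc i < n" for i
    proof -
      have "a < b" if "a div m \<in> G i" "b div m \<in> G (Suc i)" for a b
      proof -
        have "a div m < b div m"
          using G(3)[OF i] fin[of i] fin[of "Suc i"] i that by (simp add: Max_less_Min_iff)
        then show ?thesis by (metis div_le_mono leD leI)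
      qed
      then show ?thesis using finH[of i] finH[of "Suc i"] i
        by (subst Max_less_Min_iff) (auto simp: H_def)
    qed
    have "n \<le> m * Min (G 0)" using G(4) m by (metis mult_le_mono nat_mult_1 Suc_leI One_nat_def)
    also have "\<dots> \<le> Min (H 0)" unfolding H_def using Min_div_vimage(2) fin[of 0] G(1) m by simp
    finally have "n \<le> Min (H 0)" .
    moreover have "{i. i div m \<in> F} = (\<Union>i<n. H i)" using G(5) by (auto simp: H_def)
    ultimately show ?thesis
      using G(1) finH HS lt by (auto intro!: exI[of _ n] exI[of _ H])
  qed
next
  case (OLim f)
  have m: "0 < m" using OLim.prems by simp
  obtain n where n: "F = {} \<or> Suc n \<le> Min F" "F \<in> schreier (f n)" using OLim.prems by auto
  have fin: "finite F" "F \<subseteq> {1..}" using schreier_finite[OF n(2)] by auto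
  show ?case
  proof (cases "F = {}")
    case True
    then show ?thesis using n by (auto intro: exI[of _ n])
  next
    case False
    have min: "m * Min F \<le> Min {i. i div m \<in> F}" by (rule Min_div_vimage(2)[OF fin(1) False m])
    show ?thesis
    \<comment> \<open>A fundamental sequence may start at zero, where the induction hypothesis does
      not apply. Then \<open>F\<close> is a singleton of a positive integer, and its block has m
      points, all at least m.\<close>
    proof (cases "f n = OZero")
      case True
      then have "card F \<le> 1" using n by simp
      moreover have "1 \<le> Min F" using False fin by auto
      moreover have "card {i. i div m \<in> F} = m * card F" by (rule card_div_vimage[OF fin(1) m])
      ultimately have "card {i. i div m \<in> F} \<le> Min {i. i div m \<in> F}"
        using min by (metis le_trans mult_le_mono2)
      then show ?thesis
        by (intro card_le_Min_imp_schreier OLim.prems finite_div_vimage Min_div_vimage fin False m)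
    next
      case nz: False
      have "{i. i div m \<in> F} \<in> schreier (f n)"
        using OLim.IH[of "f n" F] ord_wf_OLimD[OF OLim.prems(1)] nz OLim.prems(3) n(2) by auto
      moreover have "Suc n \<le> Min {i. i div m \<in> F}"
      proof -
        have "Suc n \<le> Min F" using n False by auto
        also have "\<dots> \<le> m * Min F" using m by simp
        finally show ?thesis using min by linarith
      qed
      ultimately show ?thesis by auto
    qed
  qed
qed auto

section \<open>Sums, spreading models and operators on Banach space types\<close>

lemma nsum_type_sp: "finite E \<Longrightarrow> nsum (type_sp :: 'a::real_normed_vector nspace) E g = sum g E"
proof -
  assume "finite E"
  have "foldr (+) (map g xs) 0 = sum g (set xs)" if "distinct xs" for xs :: "nat list"
    using that by (induction xs) auto
  from this[of "sorted_list_of_set E"] show ?thesis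
    using \<open>finite E\<close> by (simp add: nsum_def type_sp_def)
qed

lemma l1_spreading_model_type_sp:
  "l1_spreading_model \<xi> (type_sp :: 'a::real_normed_vector nspace) x \<longleftrightarrow>
    (\<exists>M. \<forall>n. norm (x n) \<le> M) \<and>
    (\<exists>K>0. \<forall>E\<in>schreier \<xi>. \<forall>a. (1 / K) * (\<Sum>i\<in>E. \<bar>a i\<bar>) \<le> norm (\<Sum>i\<in>E. a i *\<^sub>R x i))"
proof -
  have "nrm type_sp (nsum (type_sp :: 'a nspace) E (\<lambda>i. scal type_sp (a i) (x i)))
      = norm (\<Sum>i\<in>E. a i *\<^sub>R x i)" if "E \<in> schreier \<xi>" for E a
    using schreier_finite[OF that] by (simp add: nsum_type_sp) (simp add: type_sp_def)
  then show ?thesis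
    unfolding l1_spreading_model_def by (simp add: type_sp_def)
qed

lemma operator_type_sp_iff:
  "operator (type_sp :: 'a::real_normed_vector nspace) (type_sp :: 'b::real_normed_vector nspace) T
    \<longleftrightarrow> bounded_linear T"
proof
  assume "operator (type_sp :: 'a nspace) (type_sp :: 'b nspace) T"
  then obtain K where "\<And>x. norm (T x) \<le> K * norm x" and "\<And>x y. T (x + y) = T x + T y"
    "\<And>a x. T (a *\<^sub>R x) = a *\<^sub>R T x"
    unfolding operator_def type_sp_def by auto
  then show "bounded_linear T" by (intro bounded_linear_intro[of T K]) (auto simp: mult.commute)
next
  assume "bounded_linear T"
  then interpret bounded_linear T .
  show "operator (type_sp :: 'a nspace) (type_sp :: 'b nspace) T"
    unfolding operator_def type_sp_def using bounded by (auto simp: add scale mult.commute)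
qed

lemma sum_div_vimage:
  assumes "finite F" "0 < (m::nat)"
  shows "(\<Sum>i | i div m \<in> F. g i) = (\<Sum>j\<in>F. \<Sum>i\<in>{j * m..<j * m + m}. g i)"
proof -
  have "(\<Sum>i | i div m \<in> F. g i) = (\<Sum>j\<in>F. sum g {i \<in> {i. i div m \<in> F}. i div m = j})"
    by (rule sum.group[symmetric]) (use assms in \<open>auto intro: finite_div_vimage\<close>)
  also have "\<dots> = (\<Sum>j\<in>F. \<Sum>i | i div m = j. g i)"
    by (intro sum.cong refl) auto
  finally show ?thesis by (simp add: div_eq_interval[OF assms(2)])
qed

section \<open>The l2 sum of a sequence of equivalent norms\<close>

text \<open>The constants \<open>c n\<close> may grow with n. Finitely many coordinates are thus
  controlled by the ambient norm, whereas the full l2 sum may be infinite.\<close>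

locale interpolation =
  fixes q :: "nat \<Rightarrow> 'y::banach \<Rightarrow> real" and c :: "nat \<Rightarrow> real" and L :: real
  assumes q_add: "q n (x + y) \<le> q n x + q n y"
    and q_scale: "q n (a *\<^sub>R x) = \<bar>a\<bar> * q n x"
    and q_le_norm: "q n x \<le> c n * norm x"
    and norm_le_q: "norm x \<le> L * q 0 x"
    and c_nonneg: "0 \<le> c n" and L_pos: "0 < L"
begin

definition Q :: "nat \<Rightarrow> 'y \<Rightarrow> real" where "Q k y = L2_set (\<lambda>n. q n y) {..<k}"
definition D :: "'y set" where "D = {y. bdd_above (range (\<lambda>k. Q k y))}"
text \<open>A real supremum is meaningful only for a bounded set, so statements about
  \<open>N\<close> are restricted to \<open>D\<close>.\<close>

definition N :: "'y \<Rightarrow> real" where "N y = (SUP k. Q k y)"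

lemma q_0: "q n 0 = 0"
  using q_scale[of n 0 0] by simp

lemma q_minus: "q n (- x) = q n x"
  using q_scale[of n "-1" x] by simp

lemma q_nonneg: "0 \<le> q n x"
  using q_add[of n x "- x"] by (simp add: q_minus q_0)

lemma Q_nonneg: "0 \<le> Q k x"
  by (simp add: Q_def)

lemma Q_add: "Q k (x + y) \<le> Q k x + Q k y"
proof -
  have "Q k (x + y) \<le> L2_set (\<lambda>n. q n x + q n y) {..<k}"
    unfolding Q_def by (intro L2_set_mono q_add q_nonneg)
  also have "\<dots> \<le> Q k x + Q k y" unfolding Q_def by (rule L2_set_triangle_ineq)
  finally show ?thesis .
qed

lemma Q_scale: "Q k (a *\<^sub>R x) = \<bar>a\<bar> * Q k x"
  by (simp add: Q_def q_scale L2_set_right_distrib)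

lemma sublinear_Q: "sublinear (Q k)"
  by (auto simp: sublinear_def Q_add Q_scale)

lemma Q_le_norm: "Q k x \<le> (\<Sum>n<k. c n) * norm x"
proof -
  have "Q k x \<le> (\<Sum>n<k. q n x)" unfolding Q_def by (intro L2_set_le_sum q_nonneg)
  also have "\<dots> \<le> (\<Sum>n<k. c n * norm x)" by (intro sum_mono q_le_norm)
  finally show ?thesis by (simp add: sum_distrib_right)
qed

lemma D_I: assumes "\<And>k. Q k y \<le> B" shows "y \<in> D" "N y \<le> B"
  unfolding D_def N_def using assms by (auto intro!: bdd_aboveI cSUP_least)

lemma Q_le_N: "y \<in> D \<Longrightarrow> Q k y \<le> N y"
  unfolding D_def N_def by (auto intro: cSUP_upper)

lemma q_le_N: "y \<in> D \<Longrightarrow> q n y \<le> N y"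
  using Q_le_N[of y "Suc n"] member_le_L2_set[of "{..<Suc n}" n "\<lambda>n. q n y"]
  by (simp add: Q_def)

lemma N_nonneg: "y \<in> D \<Longrightarrow> 0 \<le> N y"
  using Q_le_N[of y 0] Q_nonneg[of 0 y] by linarith

lemma norm_le_N: "y \<in> D \<Longrightarrow> norm y \<le> L * N y"
  using norm_le_q[of y] q_le_N[of y 0] L_pos by (meson mult_left_mono less_imp_le order_trans)

lemma D_add: "x \<in> D \<Longrightarrow> y \<in> D \<Longrightarrow> x + y \<in> D"
  and N_add: "x \<in> D \<Longrightarrow> y \<in> D \<Longrightarrow> N (x + y) \<le> N x + N y"
proof -
  assume "x \<in> D" "y \<in> D"
  then have "Q k (x + y) \<le> N x + N y" for k
    using Q_add[of k x y] Q_le_N[of x k] Q_le_N[of y k] by linarith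
  then show "x + y \<in> D" "N (x + y) \<le> N x + N y" by (rule D_I)+
qed

lemma D_scale: "x \<in> D \<Longrightarrow> a *\<^sub>R x \<in> D"
  and N_scale_le: "x \<in> D \<Longrightarrow> N (a *\<^sub>R x) \<le> \<bar>a\<bar> * N x"
proof -
  assume "x \<in> D"
  then have "Q k (a *\<^sub>R x) \<le> \<bar>a\<bar> * N x" for k
    using Q_le_N[of x k] by (simp add: Q_scale mult_left_mono)
  then show "a *\<^sub>R x \<in> D" "N (a *\<^sub>R x) \<le> \<bar>a\<bar> * N x" by (rule D_I)+
qed

lemma D_0: "0 \<in> D" and N_0: "N 0 = 0"
proof -
  have "Q k 0 \<le> 0" for k by (simp add: Q_def q_0 L2_set_0')
  then show "0 \<in> D" "N 0 = 0" using D_I[of 0 0] N_nonneg[of 0] by (auto intro: antisym)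
qed

lemma N_scale: assumes "x \<in> D" shows "N (a *\<^sub>R x) = \<bar>a\<bar> * N x"
proof (cases "a = 0")
  case False
  have "N x \<le> \<bar>1 / a\<bar> * N (a *\<^sub>R x)"
    using N_scale_le[OF D_scale[OF assms, of a], of "1 / a"] False by simp
  then have "\<bar>a\<bar> * N x \<le> N (a *\<^sub>R x)" using False by (simp add: field_simps)
  then show ?thesis using N_scale_le[OF assms] by (simp add: antisym)
qed (simp add: N_0)

lemma D_minus: "x \<in> D \<Longrightarrow> - x \<in> D" and N_minus: "x \<in> D \<Longrightarrow> N (- x) = N x"
  using D_scale[of x "-1"] N_scale[of x "-1"] by auto

lemma D_diff: "x \<in> D \<Longrightarrow> y \<in> D \<Longrightarrow> x - y \<in> D"
  using D_add[of x "- y"] D_minus[of y] by simp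

lemma N_eq_0: "x \<in> D \<Longrightarrow> N x = 0 \<longleftrightarrow> x = 0"
  using norm_le_N[of x] N_0 by auto

lemma D_sum: "(\<And>i. i \<in> F \<Longrightarrow> z i \<in> D) \<Longrightarrow> (\<Sum>i\<in>F. z i) \<in> D"
  by (induction F rule: infinite_finite_induct) (auto simp: D_0 D_add)

lemma N_sum: "(\<And>i. i \<in> F \<Longrightarrow> z i \<in> D) \<Longrightarrow> N (\<Sum>i\<in>F. z i) \<le> (\<Sum>i\<in>F. N (z i))"
proof (induction F rule: infinite_finite_induct)
  case (insert i F)
  then have "N (z i + sum z F) \<le> N (z i) + N (sum z F)" by (intro N_add D_sum) auto
  then show ?case using insert by force
qed (auto simp: N_0)

text \<open>An \<open>N\<close>-Cauchy sequence converges in the ambient norm. Each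
  \<open>Q k\<close> is continuous for that norm, so letting m tend to infinity turns the Cauchy
  estimate into a bound on the distance to the limit that is uniform in k.\<close>

lemma D_complete:
  fixes y :: "nat \<Rightarrow> 'y"
  assumes y: "\<And>n. y n \<in> D" and C: "\<And>e. 0 < e \<Longrightarrow> \<exists>M. \<forall>m\<ge>M. \<forall>n\<ge>M. N (y m - y n) < e"
  shows "\<exists>l\<in>D. \<forall>e>0. \<exists>M. \<forall>n\<ge>M. N (y n - l) < e"
proof -
  have "Cauchy y"
  proof (rule CauchyI)
    fix e :: real assume "0 < e"
    then obtain M where M: "\<forall>m\<ge>M. \<forall>n\<ge>M. N (y m - y n) < e / L" using C[of "e / L"] L_pos by auto
    have "norm (y m - y n) < e" if "m \<ge> M" "n \<ge> M" for m n
    proof -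
      have "norm (y m - y n) \<le> L * N (y m - y n)" by (intro norm_le_N D_diff y)
      also have "\<dots> < e" using M that L_pos by (simp add: field_simps)
      finally show ?thesis .
    qed
    then show "\<exists>M. \<forall>m\<ge>M. \<forall>n\<ge>M. norm (y m - y n) < e" by blast
  qed
  then obtain l where l: "y \<longlonglongrightarrow> l" using Cauchy_convergent convergent_def by blast
  have lim: "\<exists>M. \<forall>n\<ge>M. y n - l \<in> D \<and> N (y n - l) < e" if "0 < e" for e
  proof -
    obtain M where M: "\<forall>m\<ge>M. \<forall>n\<ge>M. N (y m - y n) < e / 2" using C[of "e / 2"] \<open>0 < e\<close> by auto
    have Qe: "Q k (y n - l) \<le> e / 2" if n: "n \<ge> M" for n k
    proof (rule tendsto_lowerbound)
      show "(\<lambda>m. e / 2 + (\<Sum>i<k. c i) * norm (y m - l)) \<longlonglongrightarrow> e / 2"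
        by (rule tendsto_eq_intros refl tendsto_norm l LIM_zero[OF l] | simp)+
      show "eventually (\<lambda>m. Q k (y n - l) \<le> e / 2 + (\<Sum>i<k. c i) * norm (y m - l)) sequentially"
        using eventually_ge_at_top[of M]
      proof eventually_elim
        case (elim m)
        have "Q k (y n - l) \<le> Q k (y n - y m) + Q k (y m - l)"
          using Q_add[of k "y n - y m" "y m - l"] by simp
        also have "Q k (y n - y m) \<le> N (y n - y m)" by (intro Q_le_N D_diff y)
        also have "\<dots> \<le> e / 2" using M n elim by (simp add: less_imp_le)
        finally show ?case using Q_le_norm[of k "y m - l"] by linarith
      qed
    qed simp
    then have "y n - l \<in> D \<and> N (y n - l) \<le> e / 2" if "n \<ge> M" for n using D_I Qe that by blast
    then show ?thesis using \<open>0 < e\<close> by (intro exI[of _ M]) fastforce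
  qed
  obtain n where "y n - l \<in> D" using lim[of 1] by auto
  then have "l \<in> D" using D_diff[OF y[of n], of "y n - l"] by simp
  then show ?thesis using lim by blast
qed

text \<open>The first \<open>p\<close> coordinates cost a multiple of the ambient norm. The
  remaining ones are handled by the tail estimate for the coordinate sequences of the z i, with the
  coefficients replaced by their absolute values.\<close>

lemma N_subseq_estimate:
  fixes z :: "nat \<Rightarrow> 'y"
  assumes z: "\<And>i. z i \<in> D" "\<And>i. N (z i) \<le> M" and e: "0 < e"
  shows "\<exists>(r :: nat \<Rightarrow> nat) C. strict_mono r \<and> 0 < C \<and> (\<forall>F a. finite F \<longrightarrow> N (\<Sum>i\<in>F. a i *\<^sub>R z (r i))
      \<le> C * norm (\<Sum>i\<in>F. a i *\<^sub>R z (r i)) + e * (\<Sum>i\<in>F. \<bar>a i\<bar>) + M * L2_set a F)"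
proof -
  have bd: "L2_set (\<lambda>n. q n (z i)) {..<k} \<le> M" for i k
    using Q_le_N[OF z(1)[of i], of k] z(2)[of i] by (simp add: Q_def)
  obtain r :: "nat \<Rightarrow> nat" and p where r: "strict_mono r" and est:
    "\<forall>F c k. finite F \<longrightarrow> (\<forall>i. 0 \<le> c i) \<longrightarrow>
      L2_set (\<lambda>n. \<Sum>i\<in>F. c i * q n (z (r i))) {p..<k} \<le> e * sum c F + M * L2_set c F"
    using L2_bounded_subseq_tail_estimate[of "\<lambda>i n. q n (z i)" M e, OF q_nonneg bd e]
    by blast
  \<comment> \<open>Adding 1 makes the constant positive even when p = 0.\<close>
  define C where "C = (\<Sum>n<p. c n) + 1"
  have "C > 0" unfolding C_def using c_nonneg by (simp add: add_nonneg_pos sum_nonneg)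
  have main: "N (\<Sum>i\<in>F. a i *\<^sub>R z (r i))
      \<le> C * norm (\<Sum>i\<in>F. a i *\<^sub>R z (r i)) + e * (\<Sum>i\<in>F. \<bar>a i\<bar>) + M * L2_set a F" if F: "finite F" for F a
  proof (rule D_I(2))
    fix k
    let ?w = "\<Sum>i\<in>F. a i *\<^sub>R z (r i)"
    have qw: "q n ?w \<le> (\<Sum>i\<in>F. \<bar>a i\<bar> * q n (z (r i)))" for n
      using F
    proof (induction F rule: finite_induct)
      case (insert i F)
      then show ?case
        using q_add[of n "a i *\<^sub>R z (r i)" "\<Sum>i\<in>F. a i *\<^sub>R z (r i)"] by (simp add: q_scale)
    qed (simp add: q_0)
    have "Q k ?w \<le> L2_set (\<lambda>n. q n ?w) ({..<p} \<union> {p..<k})"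
      unfolding Q_def by (intro L2_set_subset_mono) auto
    also have "\<dots> \<le> Q p ?w + L2_set (\<lambda>n. q n ?w) {p..<k}"
      unfolding L2_set_def Q_def
      by (subst sum.union_disjoint) (auto intro!: sqrt_add_le_add_sqrt sum_nonneg)
    also have "Q p ?w \<le> C * norm ?w"
      using Q_le_norm[of p ?w] norm_ge_zero[of ?w] unfolding C_def distrib_right by linarith
    also have "L2_set (\<lambda>n. q n ?w) {p..<k} \<le> L2_set (\<lambda>n. \<Sum>i\<in>F. \<bar>a i\<bar> * q n (z (r i))) {p..<k}"
      by (intro L2_set_mono qw q_nonneg)
    also have "\<dots> \<le> e * (\<Sum>i\<in>F. \<bar>a i\<bar>) + M * L2_set (\<lambda>i. \<bar>a i\<bar>) F"
      by (intro est[rule_format] F) auto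
    finally show "Q k ?w \<le> C * norm ?w + e * (\<Sum>i\<in>F. \<bar>a i\<bar>) + M * L2_set a F"
      by (simp add: L2_set_def)
  qed
  show ?thesis by (intro exI[of _ r] exI[of _ C] conjI allI impI r \<open>C > 0\<close> main)
qed

end

section \<open>A copy of the interpolation space on another carrier type\<close>

locale interpolation_copy = interpolation q c L
  for q :: "nat \<Rightarrow> 'y::banach \<Rightarrow> real" and c :: "nat \<Rightarrow> real" and L :: real +
  fixes rep :: "'y \<Rightarrow> 's"
  assumes inj_rep: "inj_on rep D"
begin

text \<open>On the carrier, \<open>J\<close> decodes a point and is at the same time the inclusion
  into the ambient space; it will be the second factor of A.\<close>

definition J :: "'s \<Rightarrow> 'y" where "J = the_inv_into D rep"

definition Z :: "'s nspace" where
  "Z = \<lparr>carrier = rep ` D, add = \<lambda>s t. rep (J s + J t), scal = \<lambda>a s. rep (a *\<^sub>R J s),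
    zer = rep 0, nrm = \<lambda>s. N (J s)\<rparr>"

lemma J_rep [simp]: "y \<in> D \<Longrightarrow> J (rep y) = y"
  by (simp add: J_def the_inv_into_f_f inj_rep)

lemma rep_J: "s \<in> carrier Z \<Longrightarrow> rep (J s) = s" and J_in_D: "s \<in> carrier Z \<Longrightarrow> J s \<in> D"
  by (auto simp: Z_def)

lemma Z_simps [simp]:
  "carrier Z = rep ` D" "zer Z = rep 0"
  "x \<in> D \<Longrightarrow> y \<in> D \<Longrightarrow> add Z (rep x) (rep y) = rep (x + y)"
  "x \<in> D \<Longrightarrow> scal Z a (rep x) = rep (a *\<^sub>R x)"
  "x \<in> D \<Longrightarrow> nrm Z (rep x) = N x"
  by (auto simp: Z_def)

lemma rep_eq_iff: "x \<in> D \<Longrightarrow> y \<in> D \<Longrightarrow> rep x = rep y \<longleftrightarrow> x = y"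
  using inj_rep by (auto simp: inj_on_def)

lemma banach_Z: "banach_sp Z"
proof -
  have complete: "\<exists>l\<in>carrier Z. \<forall>e>0. \<exists>M. \<forall>n\<ge>M. nrm Z (add Z (s n) (scal Z (- 1) l)) < e"
    if s: "\<And>n. s n \<in> carrier Z"
      and C: "\<And>e. 0 < e \<Longrightarrow> \<exists>M. \<forall>m\<ge>M. \<forall>n\<ge>M. nrm Z (add Z (s m) (scal Z (- 1) (s n))) < e" for s :: "nat \<Rightarrow> 's"
  proof -
    have J: "J (s n) \<in> D" for n using s by (rule J_in_D)
    have diff: "nrm Z (add Z (s n) (scal Z (- 1) (rep y))) = N (J (s n) - y)" if "y \<in> D" for n y
    proof -
      have "add Z (rep (J (s n))) (scal Z (- 1) (rep y)) = rep (J (s n) - y)"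
        using D_minus[OF that] J that by simp
      then show ?thesis using rep_J[OF s, of n] D_diff[OF J that] by simp
    qed
    have "N (J (s m) - J (s n)) = nrm Z (add Z (s m) (scal Z (- 1) (s n)))" for m n
      using diff[OF J] rep_J[OF s] by metis
    then obtain l where l: "l \<in> D" "\<forall>e>0. \<exists>M. \<forall>n\<ge>M. N (J (s n) - l) < e"
      using D_complete[of "\<lambda>n. J (s n)", OF J] C by auto
    then have "\<forall>e>0. \<exists>M. \<forall>n\<ge>M. nrm Z (add Z (s n) (scal Z (- 1) (rep l))) < e"
      by (simp only: diff[OF l(1)])
    then show ?thesis using l(1) by (intro bexI[of _ "rep l"]) simp_all
  qed
  have "\<exists>t\<in>carrier Z. add Z s t = zer Z" if "s \<in> carrier Z" for s
    using that D_minus by (intro bexI[of _ "rep (- J s)"]) auto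
  moreover have "nrm Z s = 0 \<longleftrightarrow> s = zer Z" if "s \<in> carrier Z" for s
    using that by (auto simp: N_eq_0 rep_eq_iff D_0)
  ultimately show ?thesis
    unfolding banach_sp_def
    apply (intro conjI)
    subgoal by (simp add: D_0)
    subgoal by (auto simp: D_add)
    subgoal by (auto simp: D_scale)
    subgoal by (auto simp: D_add add.assoc)
    subgoal by (auto simp: D_add add.commute)
    subgoal by (auto simp: D_0)
    subgoal by blast
    subgoal by (auto simp: D_add D_scale scaleR_add_right)
    subgoal by (auto simp: D_add D_scale scaleR_add_left)
    subgoal by (auto simp: D_scale)
    subgoal by auto
    subgoal by blast
    subgoal by (auto simp: D_scale N_scale)
    subgoal by (auto simp: D_add N_add)
    subgoal using complete by blast
    done
qed

lemma nsum_Z: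
  assumes z: "\<And>i. z i \<in> D" and "finite E"
  shows "nsum Z E (\<lambda>i. scal Z (a i) (rep (z i))) = rep (\<Sum>i\<in>E. a i *\<^sub>R z i)"
proof -
  have "foldr (add Z) (map (\<lambda>i. scal Z (a i) (rep (z i))) xs) (zer Z) = rep (\<Sum>i\<in>set xs. a i *\<^sub>R z i)"
    if "distinct xs" for xs :: "nat list"
    using that by (induction xs) (auto simp: z D_scale D_sum simp del: Z_simps(1))
  from this[of "sorted_list_of_set E"] show ?thesis
    using \<open>finite E\<close> by (simp add: nsum_def)
qed

lemma l1_spreading_model_ZD:
  assumes "l1_spreading_model \<xi> Z s"
  obtains z M K where "\<And>i. z i \<in> D" "\<And>i. N (z i) \<le> M" "0 < K"
    "\<And>E a. E \<in> schreier \<xi> \<Longrightarrow> (1 / K) * (\<Sum>i\<in>E. \<bar>a i\<bar>) \<le> N (\<Sum>i\<in>E. a i *\<^sub>R z i)"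
proof -
  obtain M K where s: "\<And>i. s i \<in> carrier Z" and M: "\<And>i. nrm Z (s i) \<le> M" and K: "0 < K"
    and low: "\<And>E a. E \<in> schreier \<xi> \<Longrightarrow>
      (1 / K) * (\<Sum>i\<in>E. \<bar>a i\<bar>) \<le> nrm Z (nsum Z E (\<lambda>i. scal Z (a i) (s i)))"
    using assms unfolding l1_spreading_model_def by blast
  define z where "z i = J (s i)" for i
  have z: "z i \<in> D" for i unfolding z_def by (rule J_in_D[OF s])
  have sz: "s i = rep (z i)" for i unfolding z_def using rep_J[OF s] by simp
  show thesis
  proof (rule that[of z M K])
    show "N (z i) \<le> M" for i using M[of i] z by (simp add: sz)
    show "(1 / K) * (\<Sum>i\<in>E. \<bar>a i\<bar>) \<le> N (\<Sum>i\<in>E. a i *\<^sub>R z i)" if "E \<in> schreier \<xi>" for E a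
    proof -
      have "finite E" using schreier_finite[OF that] by simp
      then show ?thesis
        using low[OF that, of a] Z_simps(5)[OF D_sum, of E "\<lambda>i. a i *\<^sub>R z i"]
        unfolding sz nsum_Z[OF z \<open>finite E\<close>] by (simp add: z D_scale)
    qed
  qed (use z K in auto)
qed

lemma operator_Z_id: "operator Z Z id"
  unfolding operator_def by (auto intro!: exI[of _ 1])

lemma operator_J: "operator Z type_sp J"
  unfolding operator_def type_sp_def
  by (auto simp: D_add D_scale norm_le_N intro!: exI[of _ L])

end

section \<open>The interpolation space of an operator\<close>

locale interpolated_operator =
  fixes A :: "'x::banach \<Rightarrow> 'y::banach"
  assumes A: "bounded_linear A"
begin

text \<open>Up to a factor 2 this is the gauge of 2^n A(ball) + 2^(-n) ball. The additive form makes
  the triangle inequality immediate.\<close>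

definition q :: "nat \<Rightarrow> 'y \<Rightarrow> real" where
  "q n y = (INF x. norm x / 2 ^ n + 2 ^ n * norm (y - A x))"

text \<open>The maximum with 1 lets one constant bound both \<open>A\<close> and the identity in the
  comparison of the norm with \<open>q 0\<close>, and keeps it positive when A = 0.\<close>

definition L :: real where "L = max 1 (onorm A)"

lemma L_ge_1: "1 \<le> L" by (simp add: L_def)

lemma norm_A: "norm (A x) \<le> L * norm x"
proof -
  have "norm (A x) \<le> onorm A * norm x" by (rule onorm[OF A])
  also have "\<dots> \<le> L * norm x" by (intro mult_right_mono) (auto simp: L_def)
  finally show ?thesis .
qed

lemma q_le: "q n y \<le> norm x / 2 ^ n + 2 ^ n * norm (y - A x)"
  unfolding q_def by (rule cINF_lower) (auto intro!: bdd_belowI2[of _ 0])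

lemma le_q: "(\<And>x. b \<le> norm x / 2 ^ n + 2 ^ n * norm (y - A x)) \<Longrightarrow> b \<le> q n y"
  unfolding q_def by (rule cINF_greatest) auto

lemma q_lessD: "q n y < b \<Longrightarrow> \<exists>x. norm x / 2 ^ n + 2 ^ n * norm (y - A x) < b"
  using le_q[of b n y] by (meson leD leI)

sublocale interpolation q "\<lambda>n. 2 ^ n" L
proof
  interpret A: bounded_linear A by (rule A)
  fix n x y and a :: real
  show "q n (x + y) \<le> q n x + q n y"
    unfolding q_def[of n x] q_def[of n y]
  proof (rule le_cINF_add)
    fix u v
    have "q n (x + y) \<le> norm (u + v) / 2 ^ n + 2 ^ n * norm (x + y - A (u + v))" by (rule q_le)
    also have "\<dots> \<le> (norm u + norm v) / 2 ^ n + 2 ^ n * (norm (x - A u) + norm (y - A v))"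
      using norm_triangle_ineq[of "x - A u" "y - A v"]
      by (intro add_mono divide_right_mono mult_left_mono norm_triangle_ineq)
        (auto simp: A.add algebra_simps)
    also have "\<dots> = (norm u / 2 ^ n + 2 ^ n * norm (x - A u)) + (norm v / 2 ^ n + 2 ^ n * norm (y - A v))"
      by (simp add: algebra_simps add_divide_distrib)
    finally show "q n (x + y) \<le> \<dots>" .
  qed auto
  have scale_le: "q n (b *\<^sub>R y) \<le> \<bar>b\<bar> * q n y" if "b \<noteq> 0" for b y
  proof -
    have "q n (b *\<^sub>R y) / \<bar>b\<bar> \<le> q n y"
    proof (rule le_q)
      fix x
      have "q n (b *\<^sub>R y) \<le> norm (b *\<^sub>R x) / 2 ^ n + 2 ^ n * norm (b *\<^sub>R y - A (b *\<^sub>R x))" by (rule q_le)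
      also have "\<dots> = \<bar>b\<bar> * (norm x / 2 ^ n + 2 ^ n * norm (y - A x))"
        unfolding A.scaleR scaleR_diff_right[symmetric] norm_scaleR by (simp add: algebra_simps)
      finally show "q n (b *\<^sub>R y) / \<bar>b\<bar> \<le> norm x / 2 ^ n + 2 ^ n * norm (y - A x)"
        using that by (simp add: field_simps)
    qed
    then show ?thesis using that by (simp add: field_simps)
  qed
  show "q n (a *\<^sub>R x) = \<bar>a\<bar> * q n x"
  proof (cases "a = 0")
    case True
    have "q n 0 \<le> 0" using q_le[of n 0 0] by (simp add: A.zero)
    moreover have "0 \<le> q n 0" by (rule le_q) simp
    ultimately show ?thesis using True by simp
  next
    case False
    then have "q n x \<le> (1 / \<bar>a\<bar>) * q n (a *\<^sub>R x)" using scale_le[of "1 / a" "a *\<^sub>R x"] by simp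
    then have "\<bar>a\<bar> * q n x \<le> q n (a *\<^sub>R x)" using False by (simp add: field_simps)
    then show ?thesis using scale_le[OF False, of x] by (simp add: antisym)
  qed
  show "q n x \<le> 2 ^ n * norm x" using q_le[of n x 0] by (simp add: A.zero)
  have "norm x / L \<le> q 0 x"
  proof (rule le_q)
    fix u
    have "norm x \<le> norm (A u) + norm (x - A u)" using norm_triangle_ineq[of "A u" "x - A u"] by simp
    also have "\<dots> \<le> L * norm u + L * norm (x - A u)"
      using norm_A[of u] mult_right_mono[OF L_ge_1, of "norm (x - A u)"] by simp
    finally show "norm x / L \<le> norm u / 2 ^ 0 + 2 ^ 0 * norm (x - A u)"
      using L_ge_1 by (simp add: field_simps)
  qed
  then show "norm x \<le> L * q 0 x" using L_ge_1 by (simp add: field_simps)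
  show "0 < L" using L_ge_1 by simp
qed simp

text \<open>Both terms in the definition of \<open>q n\<close> are nonnegative, so each is bounded
  by \<open>M\<close>. A larger n gives a better approximation at the price of a larger preimage,
  uniformly over an \<open>N\<close>-ball.\<close>

lemma D_decompose:
  assumes "y \<in> D" "N y < M"
  obtains x where "norm x \<le> M * 2 ^ n" "norm (y - A x) \<le> M / 2 ^ n"
proof -
  have "q n y < M" using q_le_N[OF assms(1), of n] assms(2) by simp
  then obtain x where x: "norm x / 2 ^ n + 2 ^ n * norm (y - A x) < M" using q_lessD by blast
  have "0 \<le> norm x / 2 ^ n" "0 \<le> 2 ^ n * norm (y - A x)" by auto
  then have "norm x / 2 ^ n \<le> M" "2 ^ n * norm (y - A x) \<le> M" using x by linarith+
  then show thesis using that[of x] by (simp add: field_simps)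
qed

text \<open>Taking \<open>x\<close> itself in the infimum removes the error term and leaves a
  geometric sequence, whose l1 norm bounds the l2 norm.\<close>

lemma A_in_D: "A x \<in> D" and N_A: "N (A x) \<le> 2 * norm x"
proof -
  have "Q k (A x) \<le> 2 * norm x" for k
  proof -
    have "Q k (A x) \<le> (\<Sum>n<k. q n (A x))" unfolding Q_def by (intro L2_set_le_sum q_nonneg)
    also have "\<dots> \<le> (\<Sum>n<k. norm x / 2 ^ n)"
      using q_le[of _ "A x" x] by (intro sum_mono) simp
    also have "\<dots> = norm x * (2 - 2 / 2 ^ k)"
      by (induction k) (auto simp: field_simps)
    also have "\<dots> \<le> norm x * 2" by (intro mult_left_mono) auto
    finally show ?thesis by simp
  qed
  then show "A x \<in> D" "N (A x) \<le> 2 * norm x" by (rule D_I)+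
qed

text \<open>Points of D are coded by sequences in the source space of A: such a sequence recovers y as
  the limit of its image under A.\<close>

definition rep :: "'y \<Rightarrow> nat \<Rightarrow> 'x" where
  "rep y = (SOME s. (\<lambda>n. A (s n)) \<longlonglongrightarrow> y)"

lemma rep_limit:
  assumes "y \<in> D" shows "(\<lambda>n. A (rep y n)) \<longlonglongrightarrow> y"
proof -
  have "\<exists>x. norm (y - A x) \<le> (N y + 1) / 2 ^ n" for n
    using D_decompose[OF assms, of "N y + 1" n] by auto
  then obtain s where s: "\<And>n. norm (y - A (s n)) \<le> (N y + 1) / 2 ^ n" by metis
  have "(\<lambda>n. A (s n) - y) \<longlonglongrightarrow> 0"
  proof (rule Lim_null_comparison)
    show "eventually (\<lambda>n. norm (A (s n) - y) \<le> (N y + 1) * (1 / 2) ^ n) sequentially"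
      using s by (auto simp: norm_minus_commute power_divide intro!: always_eventually)
    show "(\<lambda>n. (N y + 1) * (1 / 2) ^ n) \<longlonglongrightarrow> 0"
      by (intro tendsto_mult_right_zero LIMSEQ_power_zero) simp
  qed
  then have "(\<lambda>n. A (s n)) \<longlonglongrightarrow> y" by (rule LIM_zero_cancel)
  then show ?thesis unfolding rep_def by (rule someI[where P = "\<lambda>s. (\<lambda>n. A (s n)) \<longlonglongrightarrow> y"])
qed

sublocale interpolation_copy q "\<lambda>n. 2 ^ n" L rep
proof
  show "inj_on rep D"
  proof (rule inj_onI)
    fix x y assume xy: "x \<in> D" "y \<in> D" "rep x = rep y"
    show "x = y" using rep_limit[OF xy(1)] rep_limit[OF xy(2)] xy(3) LIMSEQ_unique by metis
  qed
qed

lemma operator_rep_A: "operator type_sp Z (rep \<circ> A)"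
proof -
  interpret A: bounded_linear A by (rule A)
  show ?thesis
    unfolding operator_def type_sp_def using A_in_D N_A
    by (auto simp: A.add A.scale intro!: exI[of _ 2])
qed

lemma A_factors: "A = J \<circ> (rep \<circ> A)"
  using A_in_D by (auto simp: fun_eq_iff)

text \<open>Blocks of length m of a good subsequence average away the part of the sequence that lives
  on disjoint coordinates, where the norm is of type l2; what remains is seen by finitely many
  coordinates, hence by the norm of the ambient space.\<close>

lemma block_averages_l1:
  fixes z :: "nat \<Rightarrow> 'y"
  assumes \<xi>: "ord_wf \<xi>" "\<xi> \<noteq> OZero"
    and z: "\<And>i. z i \<in> D" "\<And>i. N (z i) \<le> M" and K: "0 < K"
    and low: "\<And>E a. E \<in> schreier \<xi> \<Longrightarrow> (1 / K) * (\<Sum>i\<in>E. \<bar>a i\<bar>) \<le> N (\<Sum>i\<in>E. a i *\<^sub>R z i)"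
  obtains u K' where "\<And>j. u j \<in> D" "\<And>j. N (u j) \<le> M" "0 < K'"
    "\<And>F b. F \<in> schreier \<xi> \<Longrightarrow> (1 / K') * (\<Sum>j\<in>F. \<bar>b j\<bar>) \<le> norm (\<Sum>j\<in>F. b j *\<^sub>R u j)"
proof -
  have M0: "0 \<le> M" using N_nonneg[OF z(1)[of 0]] z(2)[of 0] by linarith
  \<comment> \<open>Of the lower constant 1/K, one quarter is spent on the l1 error and one quarter
    on the l2 term. The remaining half gives the final constant 2 * K * C.\<close>
  have K4: "0 < 1 / (4 * K)" using K by simp
  obtain r :: "nat \<Rightarrow> nat" and C where r: "strict_mono r" and C: "0 < C" and est:
    "\<forall>F a. finite F \<longrightarrow> N (\<Sum>i\<in>F. a i *\<^sub>R z (r i))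
      \<le> C * norm (\<Sum>i\<in>F. a i *\<^sub>R z (r i)) + (1 / (4 * K)) * (\<Sum>i\<in>F. \<bar>a i\<bar>) + M * L2_set a F"
    using N_subseq_estimate[of z, OF z K4] by blast
  obtain m0 :: nat where m0: "(4 * K * M)\<^sup>2 \<le> real m0" using real_arch_simple by blast
  \<comment> \<open>The blow-up of Schreier sets asks for m \<ge> 2; m \<ge> (4 * K * M)^2 makes M /
    sqrt m at most 1/(4K).\<close>
  define m where "m = max 2 m0"
  have m: "2 \<le> m" "0 < m" "0 < real m" by (auto simp: m_def)
  have "4 * K * M \<le> sqrt (real m)" using m0 by (intro real_le_rsqrt) (simp add: m_def)
  then have mM: "M / sqrt (real m) \<le> 1 / (4 * K)" using m K by (simp add: field_simps)
  define u where "u j = (1 / real m) *\<^sub>R (\<Sum>i\<in>{j * m..<j * m + m}. z (r i))" for j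
  have uD: "u j \<in> D" for j unfolding u_def by (intro D_scale D_sum z)
  have uM: "N (u j) \<le> M" for j
  proof -
    have "N (\<Sum>i\<in>{j * m..<j * m + m}. z (r i)) \<le> (\<Sum>i\<in>{j * m..<j * m + m}. N (z (r i)))"
      by (intro N_sum z)
    also have "\<dots> \<le> (\<Sum>i\<in>{j * m..<j * m + m}. M)" by (intro sum_mono z)
    also have "\<dots> = real m * M" by simp
    finally show ?thesis
      unfolding u_def using m by (subst N_scale) (auto intro!: D_sum z simp: field_simps)
  qed
  have main: "(1 / (2 * K * C)) * (\<Sum>j\<in>F. \<bar>b j\<bar>) \<le> norm (\<Sum>j\<in>F. b j *\<^sub>R u j)"
    if F: "F \<in> schreier \<xi>" for F b
  proof -
    define G where "G = {i. i div m \<in> F}"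
    \<comment> \<open>Spreading each b j evenly over its block keeps the l1 norm and divides the l2
      norm by sqrt m.\<close>
    define a where "a i = b (i div m) / real m" for i
    have finF: "finite F" using schreier_finite[OF F] by simp
    have GS: "G \<in> schreier \<xi>" unfolding G_def by (rule schreier_div_vimage[OF \<xi> m(1) F])
    then have finG: "finite G" using schreier_finite by blast
    have blk: "i div m = j" if "i \<in> {j * m..<j * m + m}" for i j
      using that unfolding div_eq_interval[OF m(2), of j, symmetric] by simp
    have w: "(\<Sum>i\<in>G. a i *\<^sub>R z (r i)) = (\<Sum>j\<in>F. b j *\<^sub>R u j)"
      unfolding G_def sum_div_vimage[OF finF m(2)]
      by (intro sum.cong refl) (simp add: u_def a_def blk scaleR_sum_right)
    have suma: "(\<Sum>i\<in>G. \<bar>a i\<bar>) = (\<Sum>j\<in>F. \<bar>b j\<bar>)"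
      unfolding G_def sum_div_vimage[OF finF m(2)]
      by (intro sum.cong refl) (use m in \<open>simp add: a_def blk\<close>)
    have "(\<Sum>i\<in>{j * m..<j * m + m}. (a i)\<^sup>2) = (b j)\<^sup>2 / real m" for j
    proof -
      have "(\<Sum>i\<in>{j * m..<j * m + m}. (a i)\<^sup>2) = (\<Sum>i\<in>{j * m..<j * m + m}. (b j / real m)\<^sup>2)"
        by (intro sum.cong refl) (simp add: a_def blk)
      then show ?thesis using m by (simp add: power2_eq_square)
    qed
    then have "(\<Sum>i\<in>G. (a i)\<^sup>2) = (\<Sum>j\<in>F. (b j)\<^sup>2) / real m"
      unfolding G_def sum_div_vimage[OF finF m(2)] sum_divide_distrib by simp
    then have "M * L2_set a G = M / sqrt (real m) * L2_set b F"
      by (simp add: L2_set_def real_sqrt_divide)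
    also have "\<dots> \<le> 1 / (4 * K) * (\<Sum>j\<in>F. \<bar>b j\<bar>)"
      using mM K by (intro mult_mono L2_set_le_sum_abs) auto
    finally have L2_le: "M * L2_set a G \<le> 1 / (4 * K) * (\<Sum>j\<in>F. \<bar>b j\<bar>)" .
    have inj: "inj_on r G" using strict_mono_imp_inj_on[OF r] by (simp add: inj_on_def)
    have inv: "inv r (r i) = i" for i using strict_mono_imp_inj_on[OF r] by simp
    \<comment> \<open>The lower bound concerns the original sequence, so it is used on the image of
      \<open>G\<close> under \<open>r\<close>, with coefficients pulled back along the inverse of
      \<open>r\<close>.\<close>
    have "(1 / K) * (\<Sum>i\<in>r ` G. \<bar>a (inv r i)\<bar>) \<le> N (\<Sum>i\<in>r ` G. a (inv r i) *\<^sub>R z i)"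
      by (intro low schreier_image_strict_mono r GS)
    then have "(1 / K) * (\<Sum>i\<in>G. \<bar>a i\<bar>) \<le> N (\<Sum>i\<in>G. a i *\<^sub>R z (r i))"
      by (simp add: sum.reindex[OF inj] inv)
    also have "\<dots> \<le> C * norm (\<Sum>i\<in>G. a i *\<^sub>R z (r i)) + (1 / (4 * K)) * (\<Sum>i\<in>G. \<bar>a i\<bar>) + M * L2_set a G"
      using est finG by blast
    finally have "(1 / K) * (\<Sum>j\<in>F. \<bar>b j\<bar>)
        \<le> C * norm (\<Sum>j\<in>F. b j *\<^sub>R u j) + 2 * (1 / (4 * K) * (\<Sum>j\<in>F. \<bar>b j\<bar>))"
      using L2_le unfolding w suma by linarith
    then show ?thesis using C K by (simp add: field_simps)
  qed
  have "0 < 2 * K * C" using K C by simp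
  then show thesis using that[of u "2 * K * C"] uD uM main by blast
qed

theorem SM1_Z:
  assumes \<xi>: "ord_wf \<xi>" "\<xi> \<noteq> OZero" and SM: "SM1 \<xi> type_sp type_sp A"
  shows "SM1 \<xi> Z Z id"
  unfolding SM1_def
proof (intro conjI notI operator_Z_id)
  interpret A: bounded_linear A by (rule A)
  assume "\<exists>s. l1_spreading_model \<xi> Z s \<and> l1_spreading_model \<xi> Z (id \<circ> s)"
  then obtain s where "l1_spreading_model \<xi> Z s" by blast
  then obtain z M0 K0 where z: "\<And>i. z i \<in> D" "\<And>i. N (z i) \<le> M0" "0 < K0"
    "\<And>E a. E \<in> schreier \<xi> \<Longrightarrow> (1 / K0) * (\<Sum>i\<in>E. \<bar>a i\<bar>) \<le> N (\<Sum>i\<in>E. a i *\<^sub>R z i)"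
    by (rule l1_spreading_model_ZD) blast
  obtain u K where u: "\<And>j. u j \<in> D" "\<And>j. N (u j) \<le> M0" and K: "0 < K"
    and low: "\<And>F b. F \<in> schreier \<xi> \<Longrightarrow> (1 / K) * (\<Sum>j\<in>F. \<bar>b j\<bar>) \<le> norm (\<Sum>j\<in>F. b j *\<^sub>R u j)"
    using block_averages_l1[OF \<xi> z] by blast
  \<comment> \<open>The decomposition of points of \<open>D\<close> asks for a strict bound on
    \<open>N\<close>.\<close>
  define M where "M = M0 + 1"
  have M: "N (u j) < M" for j using u(2)[of j] by (simp add: M_def)
  \<comment> \<open>With this n the approximation error is at most 1/(2K), so replacing
    \<open>u j\<close> by an image under \<open>A\<close> loses only half of the lower
    constant.\<close>
  obtain n where n: "M * (2 * K) < 2 ^ n" using real_arch_pow[of 2] by auto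
  have "\<exists>x. norm x \<le> M * 2 ^ n \<and> norm (u j - A x) \<le> M / 2 ^ n" for j
    using D_decompose[OF u(1) M] by metis
  then obtain x where x: "\<And>j. norm (x j) \<le> M * 2 ^ n" "\<And>j. norm (u j - A (x j)) \<le> M / 2 ^ n"
    by metis
  have Mn: "M / 2 ^ n \<le> 1 / (2 * K)" using n K by (simp add: field_simps)
  have lowA: "(1 / (2 * K)) * (\<Sum>j\<in>F. \<bar>b j\<bar>) \<le> norm (\<Sum>j\<in>F. b j *\<^sub>R A (x j))"
    if F: "F \<in> schreier \<xi>" for F b
  proof -
    have "(\<Sum>j\<in>F. b j *\<^sub>R u j) = (\<Sum>j\<in>F. b j *\<^sub>R A (x j)) + (\<Sum>j\<in>F. b j *\<^sub>R (u j - A (x j)))"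
      by (simp add: sum.distrib[symmetric] scaleR_diff_right)
    then have "norm (\<Sum>j\<in>F. b j *\<^sub>R u j)
        \<le> norm (\<Sum>j\<in>F. b j *\<^sub>R A (x j)) + norm (\<Sum>j\<in>F. b j *\<^sub>R (u j - A (x j)))"
      by (simp add: norm_triangle_ineq)
    also have "norm (\<Sum>j\<in>F. b j *\<^sub>R (u j - A (x j))) \<le> (\<Sum>j\<in>F. \<bar>b j\<bar> * (1 / (2 * K)))"
    proof (rule sum_norm_le)
      fix j
      have "norm (u j - A (x j)) \<le> 1 / (2 * K)" using x(2)[of j] Mn by linarith
      then show "norm (b j *\<^sub>R (u j - A (x j))) \<le> \<bar>b j\<bar> * (1 / (2 * K))"
        by (simp only: norm_scaleR mult_left_mono abs_ge_zero)
    qed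
    also have "\<dots> = (1 / (2 * K)) * (\<Sum>j\<in>F. \<bar>b j\<bar>)" by (simp add: sum_divide_distrib mult.commute)
    finally show ?thesis using low[OF F, of b] K by (simp add: field_simps)
  qed
  \<comment> \<open>Since \<open>A\<close> is bounded, a lower l1 estimate for the images passes
    back to the preimages, so both sequences are spreading models.\<close>
  have lowx: "(1 / (2 * K * L)) * (\<Sum>j\<in>F. \<bar>b j\<bar>) \<le> norm (\<Sum>j\<in>F. b j *\<^sub>R x j)"
    if F: "F \<in> schreier \<xi>" for F b
  proof -
    have "(1 / (2 * K)) * (\<Sum>j\<in>F. \<bar>b j\<bar>) \<le> norm (A (\<Sum>j\<in>F. b j *\<^sub>R x j))"
      using lowA[OF F, of b] by (simp add: A.sum A.scaleR)
    also have "\<dots> \<le> L * norm (\<Sum>j\<in>F. b j *\<^sub>R x j)" by (rule norm_A)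
    finally show ?thesis using K L_pos by (simp add: field_simps)
  qed
  have "norm (A (x j)) \<le> L * (M * 2 ^ n)" for j
    using norm_A[of "x j"] mult_left_mono[OF x(1)[of j], of L] L_pos by linarith
  moreover have "0 < 2 * K" "0 < 2 * K * L" using K L_pos by auto
  ultimately have "l1_spreading_model \<xi> type_sp x" "l1_spreading_model \<xi> type_sp (A \<circ> x)"
    unfolding l1_spreading_model_type_sp comp_def using x(1) lowA lowx by blast+
  then show False using SM unfolding SM1_def by blast
qed

end

section \<open>Weak compactness of the unit ball of the interpolation space\<close>

context interpolated_operator
begin

text \<open>For fixed n the approximants \<open>A (X n y)\<close> stay in a multiple of a weakly
  compact set, so they converge weakly along \<open>G\<close> to some \<open>u n\<close>. They are
  within 2/2^n of y, which makes \<open>u\<close> a Cauchy sequence and its limit the weak limit of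
  y itself.\<close>

lemma ultra_weak_limit:
  assumes wc: "weakly_compact_op type_sp type_sp A"
    and G: "ultra G" "eventually (\<lambda>y. y \<in> D \<and> N y \<le> 1) G"
  obtains l where "l \<in> D" "N l \<le> 1" "\<And>\<phi> :: 'y \<Rightarrow> real. bounded_linear \<phi> \<Longrightarrow> (\<phi> \<longlongrightarrow> \<phi> l) G"
proof -
  interpret A: bounded_linear A by (rule A)
  have G0: "G \<noteq> bot" using G(1) by (simp add: ultra_def)
  define K where "K = weak_top (type_sp :: 'y nspace) closure_of (A ` {x. norm x \<le> 1})"
  have K: "compactin (weak_top (type_sp :: 'y nspace)) K"
    using wc by (simp add: weakly_compact_op_def K_def type_sp_def)
  have AK: "A ` {x. norm x \<le> 1} \<subseteq> K"
    unfolding K_def by (intro closure_of_subset) (simp add: topspace_weak_top, simp add: type_sp_def)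
  \<comment> \<open>The decomposition needs a strict bound, and N y \<le> 1 gives N y < 2; hence the
    factors 2.\<close>
  define X where "X n y = (SOME x. norm x \<le> 2 * 2 ^ n \<and> norm (y - A x) \<le> 2 / 2 ^ n)" for n :: nat and y
  have X: "norm (X n y) \<le> 2 * 2 ^ n \<and> norm (y - A (X n y)) \<le> 2 / 2 ^ n" if "y \<in> D" "N y \<le> 1" for n y
  proof -
    have "N y < 2" using that by simp
    from D_decompose[OF \<open>y \<in> D\<close> this, of n] show ?thesis unfolding X_def by (metis (mono_tags, lifting) someI)
  qed
  have "\<exists>u. \<forall>\<phi> :: 'y \<Rightarrow> real. bounded_linear \<phi> \<longrightarrow> ((\<lambda>y. \<phi> (A (X n y))) \<longlongrightarrow> \<phi> u) G" for n
  proof -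
    \<comment> \<open>Dividing by \<open>a\<close> moves the preimages into the unit ball, where the
      compactness hypothesis applies; the limit is scaled back afterwards.\<close>
    define a :: real where "a = 2 * 2 ^ n"
    have a: "a > 0" by (simp add: a_def)
    define f where "f y = A ((1 / a) *\<^sub>R X n y)" for y
    have "eventually (\<lambda>y. y \<in> K) (filtermap f G)"
      unfolding eventually_filtermap using G(2)
    proof eventually_elim
      case (elim y)
      then have "norm ((1 / a) *\<^sub>R X n y) \<le> 1" using X[of y n] a by (simp add: field_simps a_def)
      then show ?case using AK by (auto simp: f_def)
    qed
    then obtain l where l: "\<And>V. openin (weak_top type_sp) V \<Longrightarrow> l \<in> V \<Longrightarrow> eventually (\<lambda>y. y \<in> V) (filtermap f G)"
      using compactin_ultra_limit[OF K ultra_filtermap[OF G(1)]] by blast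
    have "((\<lambda>y. \<phi> (A (X n y))) \<longlongrightarrow> \<phi> (a *\<^sub>R l)) G" if \<phi>: "bounded_linear \<phi>" for \<phi> :: "'y \<Rightarrow> real"
    proof -
      interpret \<phi>: bounded_linear \<phi> by (rule \<phi>)
      have "((\<lambda>y. \<phi> (f y)) \<longlongrightarrow> \<phi> l) G"
      proof (rule topological_tendstoI)
        fix U :: "real set" assume "open U" "\<phi> l \<in> U"
        then have "openin (weak_top type_sp) (carrier type_sp \<inter> \<phi> -` U)" "l \<in> carrier type_sp \<inter> \<phi> -` U"
          using \<phi> by (auto simp: operator_type_sp_iff intro!: openin_weak_top_vimage) (simp add: type_sp_def)
        from l[OF this] show "eventually (\<lambda>y. \<phi> (f y) \<in> U) G" by (simp add: eventually_filtermap eventually_conj_iff)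
      qed
      then have "((\<lambda>y. a * \<phi> (f y)) \<longlongrightarrow> a * \<phi> l) G" by (intro tendsto_intros)
      moreover have "a * \<phi> (f y) = \<phi> (A (X n y))" for y
        using a by (simp add: f_def A.scaleR \<phi>.scaleR)
      ultimately show ?thesis by (simp add: \<phi>.scaleR)
    qed
    then show ?thesis by blast
  qed
  then obtain u where u: "\<And>n \<phi>. bounded_linear (\<phi> :: 'y \<Rightarrow> real) \<Longrightarrow> ((\<lambda>y. \<phi> (A (X n y))) \<longlongrightarrow> \<phi> (u n)) G"
    by metis
  have u_dist: "norm (u n - u m) \<le> 2 / 2 ^ n + 2 / 2 ^ m" for n m
  proof -
    \<comment> \<open>A norming functional turns the weak limits into a norm estimate.\<close>
    obtain \<phi> where \<phi>: "bounded_linear \<phi>" "\<And>y. \<phi> y \<le> norm y" "\<phi> (u n - u m) = norm (u n - u m)"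
      using norming_functional[of "u n - u m"] by blast
    interpret \<phi>: bounded_linear \<phi> by (rule \<phi>)
    have "((\<lambda>y. \<phi> (A (X n y)) - \<phi> (A (X m y))) \<longlongrightarrow> \<phi> (u n) - \<phi> (u m)) G"
      by (intro tendsto_diff u \<phi>)
    then have "\<phi> (u n) - \<phi> (u m) \<le> 2 / 2 ^ n + 2 / 2 ^ m"
    proof (rule tendsto_upperbound[OF _ _ G0])
      show "eventually (\<lambda>y. \<phi> (A (X n y)) - \<phi> (A (X m y)) \<le> 2 / 2 ^ n + 2 / 2 ^ m) G"
        using G(2)
      proof eventually_elim
        case (elim y)
        have "\<phi> (A (X n y)) - \<phi> (A (X m y)) \<le> norm ((y - A (X m y)) - (y - A (X n y)))"
          using \<phi>(2)[of "A (X n y) - A (X m y)"] by (simp add: \<phi>.diff)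
        also have "\<dots> \<le> norm (y - A (X m y)) + norm (y - A (X n y))" by (rule norm_triangle_ineq4)
        finally show ?case using X[of y n] X[of y m] elim by linarith
      qed
    qed
    then show ?thesis using \<phi>(3) by (simp add: \<phi>.diff)
  qed
  have pow0: "(\<lambda>n. B * (2 / 2 ^ n)) \<longlonglongrightarrow> 0" for B :: real
  proof -
    have "(\<lambda>n. (2 * B) * (1 / 2) ^ n) \<longlonglongrightarrow> 0"
      by (intro tendsto_mult_right_zero LIMSEQ_power_zero) simp
    then show ?thesis by (simp add: power_divide mult.commute)
  qed
  have "Cauchy u"
  proof (rule CauchyI)
    fix e :: real assume "0 < e"
    then obtain M where M: "\<And>n. n \<ge> M \<Longrightarrow> 1 * (2 / 2 ^ n) < e / 2"
      using order_tendstoD(2)[OF pow0[of 1], of "e / 2"] unfolding eventually_sequentially by auto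
    have "norm (u m - u n) < e" if "m \<ge> M" "n \<ge> M" for m n
      using u_dist[of m n] M[OF that(1)] M[OF that(2)] by linarith
    then show "\<exists>M. \<forall>m\<ge>M. \<forall>n\<ge>M. norm (u m - u n) < e" by blast
  qed
  then obtain l where l: "u \<longlonglongrightarrow> l" using Cauchy_convergent convergent_def by blast
  have lim: "(\<phi> \<longlongrightarrow> \<phi> l) G" if \<phi>: "bounded_linear \<phi>" for \<phi> :: "'y \<Rightarrow> real"
  proof (rule tendstoI)
    fix e :: real assume e: "0 < e"
    interpret \<phi>: bounded_linear \<phi> by (rule \<phi>)
    obtain B where B: "0 < B" "\<And>x. norm (\<phi> x) \<le> norm x * B" using \<phi>.pos_bounded by blast
    have "eventually (\<lambda>n. dist (\<phi> (u n)) (\<phi> l) < e / 3) sequentially"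
      using tendstoD[OF \<phi>.tendsto[OF l], of "e / 3"] e by simp
    moreover have "eventually (\<lambda>n. B * (2 / 2 ^ n) < e / 3) sequentially"
      using order_tendstoD(2)[OF pow0[of B], of "e / 3"] e by simp
    ultimately have "eventually (\<lambda>n. dist (\<phi> (u n)) (\<phi> l) < e / 3 \<and> B * (2 / 2 ^ n) < e / 3) sequentially"
      by eventually_elim blast
    then obtain n where n: "dist (\<phi> (u n)) (\<phi> l) < e / 3" "B * (2 / 2 ^ n) < e / 3"
      using eventually_happens'[OF sequentially_bot] by blast
    have "eventually (\<lambda>y. dist (\<phi> (A (X n y))) (\<phi> (u n)) < e / 3) G"
      using tendstoD[OF u[OF \<phi>], of "e / 3"] e by simp
    then show "eventually (\<lambda>y. dist (\<phi> y) (\<phi> l) < e) G"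
      using G(2)
    proof eventually_elim
      case (elim y)
      have "dist (\<phi> y) (\<phi> (A (X n y))) \<le> norm (y - A (X n y)) * B"
        using B(2)[of "y - A (X n y)"] by (simp add: dist_norm \<phi>.diff)
      also have "\<dots> \<le> (2 / 2 ^ n) * B" using X[of y n] elim B by (intro mult_right_mono) auto
      also have "\<dots> = B * (2 / 2 ^ n)" by (rule mult.commute)
      also note n(2)
      finally have "dist (\<phi> y) (\<phi> (A (X n y))) < e / 3" .
      then show ?case
        using elim n(1) dist_triangle[of "\<phi> y" "\<phi> l" "\<phi> (A (X n y))"]
          dist_triangle[of "\<phi> (A (X n y))" "\<phi> l" "\<phi> (u n)"] by linarith
    qed
  qed
  \<comment> \<open>Weak lower semicontinuity of \<open>Q k\<close>: a bounded functional below
    \<open>Q k\<close> that attains it at \<open>l\<close> is at most 1 along \<open>G\<close>,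
    hence also at \<open>l\<close>.\<close>
  have "Q k l \<le> 1" for k
  proof -
    obtain \<phi> where \<phi>: "bounded_linear \<phi>" "\<And>y. \<phi> y \<le> Q k y" "\<And>s. s \<in> {l} \<Longrightarrow> Q k l \<le> \<phi> s"
      using Hahn_Banach_bounded[of "Q k" "\<Sum>n<k. 2 ^ n" "{l}" "Q k l"] sublinear_Q Q_le_norm by auto
    have "\<phi> l \<le> 1"
    proof (rule tendsto_upperbound[OF lim[OF \<phi>(1)] _ G0])
      show "eventually (\<lambda>y. \<phi> y \<le> 1) G"
        using G(2) by eventually_elim (use \<phi>(2) Q_le_N in \<open>meson order_trans\<close>)
    qed
    then show ?thesis using \<phi>(3)[of l] by simp
  qed
  then have "l \<in> D" "N l \<le> 1" by (rule D_I)+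
  then show thesis using that lim by blast
qed

text \<open>If the convergence failed, Mazur's lemma would yield vectors on which the functional is at
  least e and whose ambient norm tends to 0, and averages of a subsequence of those are small in
  the norm N.\<close>

lemma bounded_weak_limit_D:
  assumes G: "ultra G" "eventually (\<lambda>y. y \<in> D \<and> N y \<le> 1) G"
    and l: "l \<in> D" "N l \<le> 1" and lim: "\<And>g :: 'y \<Rightarrow> real. bounded_linear g \<Longrightarrow> (g \<longlongrightarrow> g l) G"
    and add: "\<And>x y. x \<in> D \<Longrightarrow> y \<in> D \<Longrightarrow> \<phi> (x + y) = \<phi> x + \<phi> y"
    and scale: "\<And>a x. x \<in> D \<Longrightarrow> \<phi> (a *\<^sub>R x) = a * \<phi> x"
    and bound: "\<And>x. x \<in> D \<Longrightarrow> \<bar>\<phi> x\<bar> \<le> C * N x" and C: "0 < C"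
  shows "((\<phi> :: 'y \<Rightarrow> real) \<longlongrightarrow> \<phi> l) G"
proof (rule tendstoI, rule ccontr)
  fix e :: real assume e: "0 < e" and "\<not> eventually (\<lambda>y. dist (\<phi> y) (\<phi> l) < e) G"
  then have "eventually (\<lambda>y. \<not> dist (\<phi> y) (\<phi> l) < e) G" by (intro ultra_not_eventually G)
  then have ge: "eventually (\<lambda>y. e \<le> \<bar>\<phi> y - \<phi> l\<bar>) G" by (simp add: dist_real_def not_less)
  have G0: "G \<noteq> bot" using G(1) by (simp add: ultra_def)
  \<comment> \<open>The ultrafilter decides on which side of \<open>\<phi> l\<close> the values
    stay.\<close>
  have "\<exists>\<sigma>. \<bar>\<sigma>\<bar> = 1 \<and> eventually (\<lambda>y. e \<le> \<sigma> * (\<phi> y - \<phi> l)) G"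
  proof (cases "eventually (\<lambda>y. e \<le> \<phi> y - \<phi> l) G")
    case True
    then show ?thesis by (intro exI[of _ 1]) simp
  next
    case False
    then have "eventually (\<lambda>y. \<not> e \<le> \<phi> y - \<phi> l) G" by (intro ultra_not_eventually G)
    with ge have "eventually (\<lambda>y. e \<le> - 1 * (\<phi> y - \<phi> l)) G" by eventually_elim auto
    then show ?thesis by (intro exI[of _ "- 1"]) simp
  qed
  then obtain \<sigma> :: real where \<sigma>: "\<bar>\<sigma>\<bar> = 1" "eventually (\<lambda>y. e \<le> \<sigma> * (\<phi> y - \<phi> l)) G" by blast
  \<comment> \<open>The bound 2 is that of a difference of two points of the
    \<open>N\<close>-ball.\<close>
  define T where "T = {t \<in> D. N t \<le> 2 \<and> e \<le> \<phi> t}"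
  have convT: "convex T"
  proof (rule convexI)
    fix x y and s t :: real assume xy: "x \<in> T" "y \<in> T" and st: "0 \<le> s" "0 \<le> t" "s + t = 1"
    have D: "x \<in> D" "y \<in> D" using xy by (auto simp: T_def)
    have "N (s *\<^sub>R x + t *\<^sub>R y) \<le> N (s *\<^sub>R x) + N (t *\<^sub>R y)" by (intro N_add D_scale D)
    also have "\<dots> = s * N x + t * N y" using D st by (simp add: N_scale)
    also have "\<dots> \<le> s * 2 + t * 2"
      using xy st by (intro add_mono mult_left_mono) (auto simp: T_def)
    also have "\<dots> = 2" using st by (simp flip: distrib_right)
    finally have "N (s *\<^sub>R x + t *\<^sub>R y) \<le> 2" .
    moreover have "e = s * e + t * e" using st by (simp flip: distrib_right)
    moreover have "s * e + t * e \<le> s * \<phi> x + t * \<phi> y"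
      using xy st by (intro add_mono mult_left_mono) (auto simp: T_def)
    ultimately show "s *\<^sub>R x + t *\<^sub>R y \<in> T" using D by (auto simp: T_def D_add D_scale add scale)
  qed
  have evT: "eventually (\<lambda>y. \<sigma> *\<^sub>R (y - l) \<in> T) G"
    using G(2) \<sigma>(2)
  proof eventually_elim
    case (elim y)
    have d: "y - l \<in> D" using elim l by (auto intro: D_diff)
    have "N (y + - l) \<le> N y + N (- l)" using elim by (intro N_add D_minus l) auto
    then have "N (y - l) \<le> 2" using elim l by (simp add: N_minus)
    moreover have "\<phi> (y - l) = \<phi> y - \<phi> l"
      using add[of y "- l"] scale[of l "- 1"] elim l D_minus[of l] by simp
    ultimately show ?case using elim d \<sigma>(1) by (simp add: T_def D_scale N_scale scale)
  qed
  \<comment> \<open>This is Mazur's argument: a convex set that keeps a positive distance from 0 is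
    separated from 0 by a bounded functional, against the weak convergence of \<open>y - l\<close>
    to 0.\<close>
  have small: "\<exists>t\<in>T. norm t < d" if d: "0 < d" for d
  proof (rule ccontr)
    assume no: "\<not> (\<exists>t\<in>T. norm t < d)"
    have "T \<noteq> {}" using eventually_happens'[OF G0 evT] by blast
    then obtain g where g: "bounded_linear g" "\<And>t. t \<in> T \<Longrightarrow> d \<le> g t"
      using Hahn_Banach_bounded[OF sublinear_norm, of 1 T d] convT no by (auto simp: not_less)
    interpret g: bounded_linear g by (rule g)
    have "((\<lambda>y. \<sigma> * (g y - g l)) \<longlongrightarrow> \<sigma> * (g l - g l)) G"
      by (intro tendsto_intros lim g)
    moreover have "eventually (\<lambda>y. d \<le> \<sigma> * (g y - g l)) G"
      using evT
    proof eventually_elim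
      case (elim y)
      then show ?case using g(2)[OF elim] by (simp add: g.scaleR g.diff)
    qed
    ultimately have "d \<le> \<sigma> * (g l - g l)" by (rule tendsto_lowerbound[OF _ _ G0])
    then show False using d by simp
  qed
  have "\<exists>t. t \<in> T \<and> norm t < 1 / (real j + 1)" for j :: nat
    using small[of "1 / (real j + 1)"] by auto
  then obtain w where w: "\<And>j::nat. w j \<in> T" "\<And>j. norm (w j) < 1 / (real j + 1)" by metis
  have wD: "w j \<in> D" "N (w j) \<le> 2" "e \<le> \<phi> (w j)" for j using w(1)[of j] by (auto simp: T_def)
  have e4: "0 < e / (4 * C)" using e C by simp
  obtain r :: "nat \<Rightarrow> nat" and C1 where r: "strict_mono r" and C1: "0 < C1" and est:
    "\<forall>F a. finite F \<longrightarrow> N (\<Sum>i\<in>F. a i *\<^sub>R w (r i))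
      \<le> C1 * norm (\<Sum>i\<in>F. a i *\<^sub>R w (r i)) + (e / (4 * C)) * (\<Sum>i\<in>F. \<bar>a i\<bar>) + 2 * L2_set a F"
    using N_subseq_estimate[of w, OF wD(1,2) e4] by blast
  \<comment> \<open>The length \<open>k\<close> of the average makes the l2 term small, and the
    starting index \<open>j0\<close> makes the ambient norm small. After multiplication by
    \<open>C\<close>, these and the l1 term cost at most e/4 each.\<close>
  obtain k :: nat where k: "(8 * C / e)\<^sup>2 < real k" using reals_Archimedean2 by blast
  have k0: "0 < real k" using k by (meson le_less_trans zero_le_power2)
  have "8 * C / e < sqrt (real k)" using k by (rule real_less_rsqrt)
  then have kC: "C * (2 / sqrt (real k)) < e / 4" using e k0 by (simp add: field_simps)
  obtain j0 :: nat where j0: "4 * C * C1 / e < real j0" using reals_Archimedean2 by blast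
  then have jC: "C * (C1 * (1 / (real j0 + 1))) < e / 4" using e by (simp add: field_simps)
  define F where "F = {j0..<j0 + k}"
  define v where "v = (\<Sum>i\<in>F. (1 / real k) *\<^sub>R w (r i))"
  have vD: "v \<in> D" unfolding v_def by (intro D_sum D_scale wD)
  have "norm v \<le> (\<Sum>i\<in>F. (1 / real k) * (1 / (real j0 + 1)))"
    unfolding v_def
  proof (rule sum_norm_le)
    fix i assume "i \<in> F"
    then have "j0 \<le> r i" using strict_mono_imp_increasing[OF r, of i] by (simp add: F_def)
    then have "1 / (real (r i) + 1) \<le> 1 / (real j0 + 1)" by (simp add: frac_le)
    then have "norm (w (r i)) \<le> 1 / (real j0 + 1)" using w(2)[of "r i"] by linarith
    then show "norm ((1 / real k) *\<^sub>R w (r i)) \<le> (1 / real k) * (1 / (real j0 + 1))"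
      unfolding norm_scaleR by (intro mult_mono) auto
  qed
  also have "\<dots> = 1 / (real j0 + 1)" using k0 by (simp add: F_def)
  finally have nv: "norm v \<le> 1 / (real j0 + 1)" .
  have L2: "L2_set (\<lambda>_. 1 / real k) F = 1 / sqrt (real k)"
    using k0 by (simp add: L2_set_constant F_def real_div_sqrt field_simps)
  have "N v \<le> C1 * norm v + (e / (4 * C)) * (\<Sum>i\<in>F. \<bar>1 / real k\<bar>) + 2 * L2_set (\<lambda>_. 1 / real k) F"
    using est[rule_format, of F "\<lambda>_. 1 / real k"] by (simp only: v_def) (simp add: F_def)
  also have "\<dots> \<le> C1 * (1 / (real j0 + 1)) + e / (4 * C) + 2 / sqrt (real k)"
    unfolding L2 using mult_left_mono[OF nv, of C1] C1 k0 by (simp add: F_def)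
  finally have "C * N v \<le> C * (C1 * (1 / (real j0 + 1)) + e / (4 * C) + 2 / sqrt (real k))"
    using C by (intro mult_left_mono) auto
  also have "\<dots> = C * (C1 * (1 / (real j0 + 1))) + e / 4 + C * (2 / sqrt (real k))"
    using C by (simp add: distrib_left)
  also have "\<dots> < e" using kC jC e by linarith
  finally have "C * N v < e" .
  moreover have "e \<le> \<phi> v"
  proof -
    have "finite H \<Longrightarrow> \<phi> (\<Sum>i\<in>H. (1 / real k) *\<^sub>R w (r i)) = (\<Sum>i\<in>H. (1 / real k) * \<phi> (w (r i)))" for H
    proof (induction H rule: finite_induct)
      case empty
      then show ?case using scale[OF D_0, of 0] by simp
    next
      case (insert i H)
      then show ?case by (simp add: add D_sum D_scale wD scale)
    qed
    then have "\<phi> v = (\<Sum>i\<in>F. (1 / real k) * \<phi> (w (r i)))" by (simp add: v_def F_def)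
    also have "\<dots> \<ge> (\<Sum>i\<in>F. (1 / real k) * e)" by (intro sum_mono mult_left_mono wD) auto
    also have "(\<Sum>i\<in>F. (1 / real k) * e) = e" using k0 by (simp add: F_def)
    finally show ?thesis .
  qed
  ultimately show False using bound[OF vD] by linarith
qed

text \<open>Bounded functionals of the ambient space, composed with \<open>J\<close>, already
  separate points. The property makes the compact unit ball weakly closed.\<close>

lemma Hausdorff_weak_top_Z: "Hausdorff_space (weak_top Z)"
  unfolding Hausdorff_space_def topspace_weak_top
proof (intro allI impI, elim conjE)
  fix s t assume st: "s \<in> carrier Z" "t \<in> carrier Z" "s \<noteq> t"
  then have "J s \<noteq> J t" using rep_J by metis
  obtain \<phi> where \<phi>: "bounded_linear \<phi>" "\<phi> (J s - J t) = norm (J s - J t)"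
    using norming_functional[of "J s - J t"] by blast
  interpret \<phi>: bounded_linear \<phi> by (rule \<phi>)
  have ne: "\<phi> (J s) \<noteq> \<phi> (J t)" using \<phi>(2) \<open>J s \<noteq> J t\<close> by (auto simp: \<phi>.diff)
  obtain B where B: "0 \<le> B" "\<And>x. norm (\<phi> x) \<le> norm x * B" using \<phi>.nonneg_bounded by blast
  have "norm (\<phi> y) \<le> (B * L) * N y" if "y \<in> D" for y
    using B(2)[of y] mult_right_mono[OF norm_le_N[OF that] B(1)] by (simp add: mult_ac)
  then have "operator Z type_sp (\<lambda>s. \<phi> (J s))"
    unfolding operator_def type_sp_def
    by (auto simp: D_add D_scale \<phi>.add \<phi>.scaleR intro!: exI[of _ "B * L"])
  note op = openin_weak_top_vimage[OF this]
  obtain U V where UV: "open U" "open V" "\<phi> (J s) \<in> U" "\<phi> (J t) \<in> V" "U \<inter> V = {}"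
    using hausdorff[OF ne] by blast
  show "\<exists>U V. openin (weak_top Z) U \<and> openin (weak_top Z) V \<and> s \<in> U \<and> t \<in> V \<and> disjnt U V"
    using op[OF UV(1)] op[OF UV(2)] UV st
    by (intro exI[of _ "carrier Z \<inter> (\<lambda>s. \<phi> (J s)) -` U"] exI[of _ "carrier Z \<inter> (\<lambda>s. \<phi> (J s)) -` V"])
      (auto simp: disjnt_def)
qed

theorem weakly_compact_Z:
  assumes wc: "weakly_compact_op type_sp type_sp A"
  shows "weakly_compact_op Z Z id"
proof -
  define S where "S = {s \<in> carrier Z. nrm Z s \<le> 1}"
  have "compactin (weak_top Z) S"
  proof (rule compactin_ultraI)
    show "S \<subseteq> topspace (weak_top Z)" unfolding topspace_weak_top S_def by blast
    fix F assume F: "ultra F" "eventually (\<lambda>s. s \<in> S) F"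
    define G where "G = filtermap J F"
    have G: "ultra G" unfolding G_def by (rule ultra_filtermap[OF F(1)])
    have GD: "eventually (\<lambda>y. y \<in> D \<and> N y \<le> 1) G"
      unfolding G_def eventually_filtermap
      using F(2) by eventually_elim (auto simp: S_def)
    have Fc: "eventually (\<lambda>s. s \<in> carrier Z) F"
      using F(2) by eventually_elim (auto simp: S_def)
    obtain l where l: "l \<in> D" "N l \<le> 1" and lim: "\<And>\<phi> :: 'y \<Rightarrow> real. bounded_linear \<phi> \<Longrightarrow> (\<phi> \<longlongrightarrow> \<phi> l) G"
      using ultra_weak_limit[OF wc G GD] by blast
    have "eventually (\<lambda>s. s \<in> V) F" if V: "openin (weak_top Z) V" "rep l \<in> V" for V
    proof (rule weak_top_eventuallyI[OF Fc _ V])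
      fix \<phi> assume \<phi>: "operator Z (type_sp :: real nspace) \<phi>"
      have lin: "\<And>x y. x \<in> D \<Longrightarrow> y \<in> D \<Longrightarrow> \<phi> (rep (x + y)) = \<phi> (rep x) + \<phi> (rep y)"
          "\<And>a x. x \<in> D \<Longrightarrow> \<phi> (rep (a *\<^sub>R x)) = a * \<phi> (rep x)"
        using \<phi> unfolding operator_def type_sp_def by auto
      obtain C where C: "\<forall>x\<in>D. \<bar>\<phi> (rep x)\<bar> \<le> C * N x"
        using \<phi> unfolding operator_def type_sp_def by auto
      have "((\<lambda>y. \<phi> (rep y)) \<longlongrightarrow> \<phi> (rep l)) G"
      \<comment> \<open>The bound of an operator may be any real number, whereas a positive one is
        asked for here.\<close>
      proof (rule bounded_weak_limit_D[OF G GD l lim, where C = "\<bar>C\<bar> + 1"])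
        fix x assume x: "x \<in> D"
        have "\<bar>\<phi> (rep x)\<bar> \<le> C * N x" using C x by blast
        also have "\<dots> \<le> (\<bar>C\<bar> + 1) * N x" by (intro mult_right_mono N_nonneg x) auto
        finally show "\<bar>\<phi> (rep x)\<bar> \<le> (\<bar>C\<bar> + 1) * N x" .
      qed (auto simp: lin)
      then have "((\<lambda>s. \<phi> (rep (J s))) \<longlongrightarrow> \<phi> (rep l)) F" by (simp add: G_def filterlim_filtermap)
      moreover have "eventually (\<lambda>s. \<phi> (rep (J s)) = \<phi> s) F"
        using Fc by eventually_elim (simp only: rep_J)
      ultimately show "(\<phi> \<longlongrightarrow> \<phi> (rep l)) F" by (rule Lim_transform_eventually)
    qed
    moreover have "rep l \<in> S" using l by (simp add: S_def)
    ultimately show "\<exists>l\<in>S. \<forall>V. openin (weak_top Z) V \<and> l \<in> V \<longrightarrow> eventually (\<lambda>s. s \<in> V) F" by blast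
  qed
  \<comment> \<open>Weak compactness of an operator concerns the closure of the image of the ball;
    for the identity this closure is the ball itself.\<close>
  moreover from this have "weak_top Z closure_of S = S"
    by (simp add: closure_of_eq compactin_imp_closedin Hausdorff_weak_top_Z)
  ultimately show ?thesis
    unfolding weakly_compact_op_def S_def[symmetric] by (simp add: operator_Z_id)
qed

end

theorem theoremA:
  fixes \<xi> :: ordn and A :: "'x::banach \<Rightarrow> 'y::banach"
  assumes "ord_wf \<xi>" and "\<xi> \<noteq> OZero"
  shows "(SM1 \<xi> (type_sp :: 'x nspace) (type_sp :: 'y nspace) A \<longrightarrow>
           (\<exists>Z :: (nat \<Rightarrow> 'x) nspace. \<exists>B C.
              banach_sp Z \<and> SM1 \<xi> Z Z id \<and>
              operator (type_sp :: 'x nspace) Z C \<and> operator Z (type_sp :: 'y nspace) B \<and>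
              A = B \<circ> C))
       \<and> (WC \<xi> (type_sp :: 'x nspace) (type_sp :: 'y nspace) A \<longrightarrow>
           (\<exists>Z :: (nat \<Rightarrow> 'x) nspace. \<exists>B C.
              banach_sp Z \<and> WC \<xi> Z Z id \<and>
              operator (type_sp :: 'x nspace) Z C \<and> operator Z (type_sp :: 'y nspace) B \<and>
              A = B \<circ> C))"
proof (intro conjI impI)
  assume SM: "SM1 \<xi> (type_sp :: 'x nspace) (type_sp :: 'y nspace) A"
  then interpret interpolated_operator A
    by (intro interpolated_operator.intro) (simp add: SM1_def operator_type_sp_iff)
  \<comment> \<open>The factors are \<open>rep \<circ> A\<close> into the interpolation space and
    \<open>J\<close> back into the target; the same space serves for both classes.\<close>
  show "\<exists>Z :: (nat \<Rightarrow> 'x) nspace. \<exists>B C.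
      banach_sp Z \<and> SM1 \<xi> Z Z id \<and>
      operator (type_sp :: 'x nspace) Z C \<and> operator Z (type_sp :: 'y nspace) B \<and> A = B \<circ> C"
    using banach_Z SM1_Z[OF assms SM] operator_rep_A operator_J A_factors by blast
next
  assume WC: "WC \<xi> (type_sp :: 'x nspace) (type_sp :: 'y nspace) A"
  then have wc: "weakly_compact_op (type_sp :: 'x nspace) (type_sp :: 'y nspace) A"
    and SM: "SM1 \<xi> (type_sp :: 'x nspace) (type_sp :: 'y nspace) A"
    by (simp_all add: WC_def)
  then interpret interpolated_operator A
    by (intro interpolated_operator.intro) (simp add: SM1_def operator_type_sp_iff)
  have "WC \<xi> Z Z id" unfolding WC_def using weakly_compact_Z[OF wc] SM1_Z[OF assms SM] by blast
  then show "\<exists>Z :: (nat \<Rightarrow> 'x) nspace. \<exists>B C.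
      banach_sp Z \<and> WC \<xi> Z Z id \<and>
      operator (type_sp :: 'x nspace) Z C \<and> operator Z (type_sp :: 'y nspace) B \<and> A = B \<circ> C"
    using banach_Z operator_rep_A operator_J A_factors by blast
qed

end
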